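(* Let $p$ be a prime and let $R$ be a finite commutative local unital ring with radical $J$ and residue field $R/J\cong F_p$. Let $n=\dim_{F_p} J/J^2$. If $n\leq 1$, or if $n=2$ and $p\cdot 1_R\notin J^2$, then $R$ is not coverable. Otherwise $R$ is coverable, $R$ surjects onto $F_p[x,y]/(x^2,xy,y^2)$, and $\sigma(R)=p+1$. In particular, if $R\in S(d)$ for some $d\geq 3$, then $d=p+1$ and $R\cong F_p[x,y]/(x^2,xy,y^2)$.
   Context: Rings are associative; subrings are not required to contain the multiplicative identity, nor any identity. A ring is coverable if it is a union of proper subrings. The covering number $\sigma(R)$ is the minimal number of proper subrings whose union is $R$, with $\sigma(R)=\infty$ if there is no finite such collection. For $d\geq 3$, $S(d)$ is the collection of isomorphism classes of unital rings $R$ such that $\sigma(R)=d$ and $\sigma(R/I)>d$ for every nonzero two-sided ideal $I$ of $R$. $F_p$ is the field with $p$ elements. Since the residue field is $F_p$, one has $p\cdot 1_R\in J$, so $J/J^2$ is an $F_p$-vector space. *)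

theory Defs
  imports
    "HOL-Library.Extended_Nat"
    "HOL-Algebra.Ideal_Product"
    "HOL-Algebra.QuotRing"
    "HOL-Algebra.UnivPoly"
    "HOL-Number_Theory.Residues"
    "Jordan_Normal_Form.Missing_VectorSpace"
begin

subsection \<open>Covering numbers\<close>

text \<open>Subrings need not contain an identity, so the library's \<open>subring\<close>, which is required to
  contain \<open>\<one>\<close>, is not the right notion.\<close>

definition subrng :: "'a set \<Rightarrow> ('a, 'm) ring_scheme \<Rightarrow> bool" where
  "subrng S R \<longleftrightarrow> additive_subgroup S R \<and> (\<forall>x\<in>S. \<forall>y\<in>S. x \<otimes>\<^bsub>R\<^esub> y \<in> S)"

definition proper_subrng :: "'a set \<Rightarrow> ('a, 'm) ring_scheme \<Rightarrow> bool" where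
  "proper_subrng S R \<longleftrightarrow> subrng S R \<and> S \<noteq> carrier R"

definition ring_cover :: "'a set set \<Rightarrow> ('a, 'm) ring_scheme \<Rightarrow> bool" where
  "ring_cover \<C> R \<longleftrightarrow> (\<forall>S\<in>\<C>. proper_subrng S R) \<and> \<Union>\<C> = carrier R"

definition coverable :: "('a, 'm) ring_scheme \<Rightarrow> bool" where
  "coverable R \<longleftrightarrow> (\<exists>\<C>. ring_cover \<C> R)"

text \<open>The infimum of the empty set of extended naturals is \<open>\<infinity>\<close>.\<close>

definition covering_number :: "('a, 'm) ring_scheme \<Rightarrow> enat" where
  "covering_number R = Inf {enat (card \<C>) | \<C>. finite \<C> \<and> ring_cover \<C> R}"

text \<open>Membership in \<open>S(d)\<close> is expressed on representatives: \<open>in_S d R\<close> says that the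
  isomorphism class of \<open>R\<close> belongs to \<open>S(d)\<close>. The locale \<open>ring\<close> is that of
  unital associative rings, and \<open>ideal\<close> means two-sided ideal.\<close>

definition in_S :: "nat \<Rightarrow> ('a, 'm) ring_scheme \<Rightarrow> bool" where
  "in_S d R \<longleftrightarrow> ring R \<and> covering_number R = enat d \<and>
     (\<forall>I. ideal I R \<and> I \<noteq> {\<zero>\<^bsub>R\<^esub>} \<longrightarrow> covering_number (R Quot I) > enat d)"


subsection \<open>Local rings\<close>

definition local_cring :: "('a, 'm) ring_scheme \<Rightarrow> bool" where
  "local_cring R \<longleftrightarrow> cring R \<and> (\<exists>!M. maximalideal M R)"

text \<open>For commutative rings only (in general one intersects the maximal left ideals).\<close>

definition jacobson_radical :: "('a, 'm) ring_scheme \<Rightarrow> 'a set" where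
  "jacobson_radical R = carrier R \<inter> \<Inter>{M. maximalideal M R}"

abbreviation prime_field :: "nat \<Rightarrow> int ring" where
  "prime_field p \<equiv> residue_ring (int p)"

text \<open>The additive group of \<open>J / J\<^sup>2\<close> as a module over the prime field: the residue class of an
  integer \<open>k\<close> acts as the \<open>k\<close>-fold sum. This is well defined when \<open>p \<cdot> \<one> \<in> J\<close>. The fields
  \<open>mult\<close> and \<open>one\<close> of a module record carry no meaning.\<close>

definition cotangent_space :: "nat \<Rightarrow> ('a, 'm) ring_scheme \<Rightarrow> 'a set \<Rightarrow> (int, 'a set) module" where
  "cotangent_space p R J =
     (let Q = R Quot (J \<cdot>\<^bsub>R\<^esub> J) in
      \<lparr>carrier = (\<lambda>x. (J \<cdot>\<^bsub>R\<^esub> J) +>\<^bsub>R\<^esub> x) ` J,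
       monoid.mult = monoid.mult Q, one = one Q, zero = zero Q, add = add Q,
       smult = (\<lambda>k X. add_pow Q k X)\<rparr>)"

lemma cotangent_space_vectorspace:
  assumes p: "Factorial_Ring.prime p" and R: "cring R" and J: "ideal J R"
    and pJ: "add_pow R p \<one>\<^bsub>R\<^esub> \<in> J"
  shows "vectorspace (prime_field p) (cotangent_space p R J)"
proof -
  define I where "I = J \<cdot>\<^bsub>R\<^esub> J"
  define Q where "Q = R Quot I"
  define V where "V = cotangent_space p R J"
  interpret R: cring R by fact
  interpret J: ideal J R by fact
  interpret I: ideal I R unfolding I_def using J J by (rule R.ideal_prod_is_ideal)
  interpret Q: ring Q unfolding Q_def by (rule I.quotient_is_ring)
  interpret h: ring_hom_ring R Q "(+>\<^bsub>R\<^esub>) I"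
    unfolding Q_def by (rule I.rcos_ring_hom_ring)
  have V_simps: "carrier V = (\<lambda>x. I +>\<^bsub>R\<^esub> x) ` J" "zero V = zero Q" "add V = add Q"
    "smult V = (\<lambda>k X. add_pow Q (k) X)"
    by (auto simp: V_def cotangent_space_def Let_def I_def Q_def)
  interpret F: residues_prime p "prime_field p"
    by unfold_locales (use p in auto)
  have JR: "x \<in> J \<Longrightarrow> x \<in> carrier R" for x by (rule J.a_Hcarr)
  have Vsub: "X \<in> carrier V \<Longrightarrow> X \<in> carrier Q" for X
    using JR h.hom_closed by (auto simp: V_simps)
  interpret C: subgroup "carrier V" "add_monoid Q"
  proof (rule group.subgroupI[OF Q.a_group])
    show "carrier V \<subseteq> carrier (add_monoid Q)" using Vsub by auto
    show "carrier V \<noteq> {}" using additive_subgroup.zero_closed[OF J.is_additive_subgroup] unfolding V_simps by blast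
  next
    fix a assume "a \<in> carrier V"
    then obtain x where x: "x \<in> J" "a = I +>\<^bsub>R\<^esub> x" by (auto simp: V_simps)
    have "\<ominus>\<^bsub>Q\<^esub> a = I +>\<^bsub>R\<^esub> (\<ominus>\<^bsub>R\<^esub> x)" using x JR h.hom_a_inv by simp
    moreover have "\<ominus>\<^bsub>R\<^esub> x \<in> J" using x additive_subgroup.a_inv_closed[OF J.is_additive_subgroup] by auto
    ultimately show "inv\<^bsub>add_monoid Q\<^esub> a \<in> carrier V"
      by (auto simp: V_simps a_inv_def)
  next
    fix a b assume "a \<in> carrier V" "b \<in> carrier V"
    then obtain x y where x: "x \<in> J" "a = I +>\<^bsub>R\<^esub> x" "y \<in> J" "b = I +>\<^bsub>R\<^esub> y"
      by (auto simp: V_simps)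
    have "a \<oplus>\<^bsub>Q\<^esub> b = I +>\<^bsub>R\<^esub> (x \<oplus>\<^bsub>R\<^esub> y)" using x JR h.hom_add by simp
    then show "a \<otimes>\<^bsub>add_monoid Q\<^esub> b \<in> carrier V" using additive_subgroup.a_closed[OF J.is_additive_subgroup x(1,3)] by (simp add: V_simps(1))
  qed
  have abV: "abelian_group V"
  proof (rule abelian_groupI)
    fix x assume x: "x \<in> carrier V"
    show "\<exists>y\<in>carrier V. y \<oplus>\<^bsub>V\<^esub> x = \<zero>\<^bsub>V\<^esub>"
      using C.m_inv_closed[OF x] Q.l_neg[OF Vsub[OF x]] by (auto simp: V_simps(2,3) a_inv_def)
  next
    show "\<zero>\<^bsub>V\<^esub> \<in> carrier V" using C.one_closed by (simp add: V_simps(2))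
  next
    fix x y assume "x \<in> carrier V" "y \<in> carrier V"
    then show "x \<oplus>\<^bsub>V\<^esub> y \<in> carrier V" using C.m_closed by (simp add: V_simps(3))
  qed (use Vsub in \<open>auto simp: V_simps(2,3) Q.a_assoc Q.a_comm Q.add.m_lcomm\<close>)
  have Q0: "\<zero>\<^bsub>Q\<^esub> = I" unfolding Q_def FactRing_def by (simp only: ring.select_convs)
  have pow_mem: "add_pow Q (k) X \<in> carrier V" if "X \<in> carrier V" for k :: int and X
  proof -
    have "X [^]\<^bsub>add_monoid Q\<^esub> k \<in> carrier V"
      by (rule Q.add.subgroup_int_pow_closed[OF C.subgroup_axioms that, unfolded add_pow_def])
    then show ?thesis by (simp add: add_pow_def)
  qed
  have hpow: "add_pow Q (n) (I +>\<^bsub>R\<^esub> x) = I +>\<^bsub>R\<^esub> (add_pow R (n) x)" if "x \<in> carrier R" for n :: nat and x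
    using that by (induction n) auto
  have pzero: "add_pow Q (int p) X = \<zero>\<^bsub>Q\<^esub>" if X: "X \<in> carrier V" for X
  proof -
    obtain x where x: "x \<in> J" "X = I +>\<^bsub>R\<^esub> x" using X by (auto simp: V_simps)
    have "add_pow R (p) x = (add_pow R p \<one>\<^bsub>R\<^esub>) \<otimes>\<^bsub>R\<^esub> x"
      using x JR R.add_pow_ldistr[of "\<one>\<^bsub>R\<^esub>" x p] by simp
    also have "\<dots> \<in> I" unfolding I_def using pJ x by (intro ideal_prod.prod)
    finally have "I +>\<^bsub>R\<^esub> (add_pow R (p) x) = I" by (rule R.a_rcos_zero[OF I.ideal_axioms])
    then have "add_pow Q (p) X = \<zero>\<^bsub>Q\<^esub>"
      using hpow[OF JR[OF x(1)], of p] by (simp only: x(2) Q0)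
    then show ?thesis by (simp add: add_pow_def int_pow_int)
  qed
  have pmod: "add_pow Q (k mod int p) X = add_pow Q (k) X" if "X \<in> carrier V" for k X
  proof -
    note X = Vsub[OF that]
    have "add_pow Q (k) X = add_pow Q (int p * (k div int p) + k mod int p) X" by simp
    also have "\<dots> = add_pow Q (int p * (k div int p)) X \<oplus>\<^bsub>Q\<^esub> add_pow Q (k mod int p) X"
      using Q.add.int_pow_mult[OF X] by blast
    also have "add_pow Q (int p * (k div int p)) X = add_pow Q (k div int p) (add_pow Q (int p) X)"
      using Q.add.int_pow_pow[OF X, of "k div int p" "int p"] by (simp add: mult.commute)
    also have "\<dots> = \<zero>\<^bsub>Q\<^esub>" unfolding pzero[OF that] by (rule Q.add.int_pow_one)
    finally show ?thesis using X by simp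
  qed
  have Fs: "\<one>\<^bsub>prime_field p\<^esub> = 1"
    "a \<oplus>\<^bsub>prime_field p\<^esub> b = (a + b) mod int p" "a \<otimes>\<^bsub>prime_field p\<^esub> b = (a * b) mod int p" for a b
    by (auto simp: residue_ring_def)
  have "module (prime_field p) V"
  proof (rule moduleI)
    fix a x assume "x \<in> carrier V"
    then show "a \<odot>\<^bsub>V\<^esub> x \<in> carrier V" using pow_mem by (simp add: V_simps(4))
  next
    fix a b x assume x: "x \<in> carrier V"
    show "(a \<oplus>\<^bsub>prime_field p\<^esub> b) \<odot>\<^bsub>V\<^esub> x = a \<odot>\<^bsub>V\<^esub> x \<oplus>\<^bsub>V\<^esub> b \<odot>\<^bsub>V\<^esub> x"
      using Q.add.int_pow_mult[OF Vsub[OF x]] pmod[OF x] by (simp add: V_simps(3,4) Fs)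
    show "(a \<otimes>\<^bsub>prime_field p\<^esub> b) \<odot>\<^bsub>V\<^esub> x = a \<odot>\<^bsub>V\<^esub> (b \<odot>\<^bsub>V\<^esub> x)"
      using Q.add.int_pow_pow[OF Vsub[OF x]] pmod[OF x] by (simp add: V_simps(3,4) Fs mult.commute)
    show "\<one>\<^bsub>prime_field p\<^esub> \<odot>\<^bsub>V\<^esub> x = x"
      using Q.add.int_pow_1[OF Vsub[OF x]] by (simp add: V_simps(4) Fs)
  next
    fix a x y assume "x \<in> carrier V" "y \<in> carrier V"
    then show "a \<odot>\<^bsub>V\<^esub> (x \<oplus>\<^bsub>V\<^esub> y) = a \<odot>\<^bsub>V\<^esub> x \<oplus>\<^bsub>V\<^esub> a \<odot>\<^bsub>V\<^esub> y"
      using Vsub Q.add.int_pow_distrib by (simp add: V_simps(3,4))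
  qed (rule F.cring, rule abV)
  then show ?thesis
    using F.is_field by (simp add: vectorspace_def V_def)
qed

definition cotangent_dim :: "nat \<Rightarrow> ('a, 'm) ring_scheme \<Rightarrow> 'a set \<Rightarrow> nat" where
  "cotangent_dim p R J = vectorspace.dim (prime_field p) (cotangent_space p R J)"


subsection \<open>The ring of polynomials in two variables modulo the monomials of degree two\<close>

definition poly_ring2 :: "nat \<Rightarrow> (nat \<Rightarrow> int, nat \<Rightarrow> nat \<Rightarrow> int) up_ring" where
  "poly_ring2 p = UP (UP (prime_field p))"

definition var_x :: "nat \<Rightarrow> nat \<Rightarrow> nat \<Rightarrow> int" where
  "var_x p = monom (poly_ring2 p) (monom (UP (prime_field p)) \<one>\<^bsub>prime_field p\<^esub> 1) 0"

definition var_y :: "nat \<Rightarrow> nat \<Rightarrow> nat \<Rightarrow> int" where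
  "var_y p = monom (poly_ring2 p) \<one>\<^bsub>UP (prime_field p)\<^esub> 1"

definition trunc_poly_ring2 :: "nat \<Rightarrow> (nat \<Rightarrow> nat \<Rightarrow> int) set ring" where
  "trunc_poly_ring2 p =
     poly_ring2 p Quot
       (Idl\<^bsub>poly_ring2 p\<^esub> {var_x p \<otimes>\<^bsub>poly_ring2 p\<^esub> var_x p,
                            var_x p \<otimes>\<^bsub>poly_ring2 p\<^esub> var_y p,
                            var_y p \<otimes>\<^bsub>poly_ring2 p\<^esub> var_y p})"

end

theory Submission
  imports Defs
begin

text \<open>Since the residue field is the prime field, \<open>R = \<int>\<one> + J\<close>. If \<open>J\<close> is spanned modulo \<open>J\<^sup>2\<close> by
  \<open>p\<one>\<close> and one further element \<open>x\<close>, then by Nakayama's lemma the unit \<open>\<one> + x\<close> generates \<open>R\<close> as a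
  ring without identity (a unit of a finite ring has \<open>\<one>\<close> among its powers), so no proper subring
  contains it. Otherwise a basis of \<open>J/J\<^sup>2\<close> that contains the class of \<open>p\<one>\<close>, if this is nonzero,
  has two further elements. Their coordinate functionals \<open>\<beta>\<close>, \<open>\<gamma>\<close> vanish on \<open>p\<one>\<close>, and
  \<open>k\<one> + j \<mapsto> k + \<beta>(j) x + \<gamma>(j) y\<close> is a surjection onto \<open>F\<^sub>p[x,y]/(x\<^sup>2,xy,y\<^sup>2)\<close>, which is covered by
  the \<open>p + 1\<close> subrings \<open>F\<^sub>p + L\<close> for lines \<open>L\<close> in \<open>F\<^sub>p x + F\<^sub>p y\<close>. Fewer than \<open>p + 1\<close> subrings never suffice,
  because proper additive subgroups of \<open>R\<close> have index at least \<open>p\<close> and all share \<open>\<zero>\<close>.\<close>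

subsection \<open>Bases of finite vector spaces\<close>

text \<open>An independent set that contains \<open>u\<close>, if this is nonzero, is enlarged to a
  maximal one. Finiteness of the space bounds the cardinalities, so a maximal one exists.\<close>

lemma (in vectorspace) basis_containing:
  assumes fin: "finite (carrier V)" and u: "u \<in> carrier V"
  shows "\<exists>B. basis B \<and> finite B \<and> (u = \<zero>\<^bsub>V\<^esub> \<or> u \<in> B)"
proof -
  \<comment> \<open>Empty when \<open>u\<close> is zero, so that \<open>A\<close> is independent in
    either case.\<close>
  define A where "A = {u} - {\<zero>\<^bsub>V\<^esub>}"
  let ?P = "\<lambda>S. A \<subseteq> S \<and> S \<subseteq> carrier V \<and> lin_indpt S"
  have "lin_indpt {}" by (simp add: lin_dep_def)
  have "lin_indpt A"
  proof (cases "u = \<zero>\<^bsub>V\<^esub>")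
    case True
    then show ?thesis using \<open>lin_indpt {}\<close> by (simp add: A_def)
  next
    case False
    then have "u \<notin> span {}" by (simp add: span_empty)
    then show ?thesis
      using lin_dep_iff_in_span[of "{}" u] \<open>lin_indpt {}\<close> False u by (simp add: A_def)
  qed
  moreover have "finite S \<and> card S \<le> card (carrier V)" if "?P S" for S
    using that fin by (auto intro: finite_subset card_mono)
  ultimately obtain B where B: "finite B" "maximal B ?P"
    using maximal_exists[of ?P "card (carrier V)" A] u by (force simp: A_def)
  \<comment> \<open>An independent set above \<open>B\<close> contains \<open>A\<close> as well, so
    maximality among the sets containing \<open>A\<close> is maximality among all independent
    sets.\<close>
  then have "maximal B (\<lambda>S. S \<subseteq> carrier V \<and> lin_indpt S)"
    unfolding maximal_def by (metis subset_trans)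
  then have "basis B" by (rule max_li_is_basis)
  moreover have "A \<subseteq> B" using B by (simp add: maximal_def)
  ultimately show ?thesis using B by (auto simp: A_def)
qed

text \<open>The functional sends \<open>v\<close> to its coefficient at \<open>e\<close>.
  Coefficient families are taken extensional on \<open>B\<close>, which makes them unique;
  additivity and the values on \<open>B\<close> then follow by exhibiting a family and appealing to
  uniqueness.\<close>

lemma (in vectorspace) coordinate_functional:
  assumes B: "basis B" "finite B" and e: "e \<in> B"
  shows "\<exists>c \<in> carrier V \<rightarrow> carrier K.
    (\<forall>v\<in>carrier V. \<forall>w\<in>carrier V. c (v \<oplus>\<^bsub>V\<^esub> w) = c v \<oplus>\<^bsub>K\<^esub> c w) \<and>
    (\<forall>b\<in>B. c b = (if b = e then \<one>\<^bsub>K\<^esub> else \<zero>\<^bsub>K\<^esub>))"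
proof -
  have BV: "B \<subseteq> carrier V" using B by (simp add: basis_def)
  have ex1: "\<exists>!a. a \<in> B \<rightarrow>\<^sub>E carrier K \<and> lincomb a B = v" if "v \<in> carrier V" for v
    using basis_criterion[OF B(2) BV] B(1) that by simp
  define a where "a v = (THE a. a \<in> B \<rightarrow>\<^sub>E carrier K \<and> lincomb a B = v)" for v
  have a: "a v \<in> B \<rightarrow>\<^sub>E carrier K" "lincomb (a v) B = v" if "v \<in> carrier V" for v
    using theI'[OF ex1[OF that]] by (simp_all add: a_def)
  have uniq: "b = a v" if "v \<in> carrier V" "b \<in> B \<rightarrow>\<^sub>E carrier K" "lincomb b B = v" for v b
    unfolding a_def using that by (intro the1_equality[symmetric, OF ex1]) simp_all
  have restr: "lincomb (restrict f B) B = lincomb f B" if "f \<in> B \<rightarrow> carrier K" for f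
    using lincomb_restrict[OF BV that, of "restrict f B"] by simp
  show ?thesis
  proof (intro bexI[of _ "\<lambda>v. a v e"] conjI ballI)
    show "(\<lambda>v. a v e) \<in> carrier V \<rightarrow> carrier K" using PiE_mem[OF a(1) e] by blast
  next
    fix v w assume vw: "v \<in> carrier V" "w \<in> carrier V"
    let ?s = "\<lambda>b. a v b \<oplus>\<^bsub>K\<^esub> a w b"
    have av: "a v \<in> B \<rightarrow> carrier K" "a w \<in> B \<rightarrow> carrier K"
      using a(1)[OF vw(1)] a(1)[OF vw(2)] by (simp_all add: PiE_def)
    have s: "?s \<in> B \<rightarrow> carrier K" using av by (simp add: Pi_iff)
    have "lincomb (restrict ?s B) B = v \<oplus>\<^bsub>V\<^esub> w"
      using restr[OF s] lincomb_sum[OF B(2) BV av] a(2) vw by simp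
    then have "restrict ?s B = a (v \<oplus>\<^bsub>V\<^esub> w)"
      using uniq[of "v \<oplus>\<^bsub>V\<^esub> w" "restrict ?s B"] s vw by (simp add: restrict_PiE_iff Pi_iff)
    then have "a (v \<oplus>\<^bsub>V\<^esub> w) e = restrict ?s B e" by (rule arg_cong[symmetric])
    then show "a (v \<oplus>\<^bsub>V\<^esub> w) e = a v e \<oplus>\<^bsub>K\<^esub> a w e" using e by simp
  next
    fix b assume b: "b \<in> B"
    let ?d = "\<lambda>x. if x = b then \<one>\<^bsub>K\<^esub> else \<zero>\<^bsub>K\<^esub>"
    have d: "?d \<in> B \<rightarrow> carrier K" by auto
    have "{b} \<union> (B - {b}) = B" using b by blast
    then have "lincomb ?d B = lincomb ?d {b}"
      using lincomb_clean[of "{b}" "B - {b}" ?d] B(2) BV b by (simp add: Pi_def subset_iff)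
    also have "\<dots> = b" using subsetD[OF BV b] by (simp add: lincomb_def)
    finally have "lincomb (restrict ?d B) B = b" using restr[OF d] by simp
    then have "restrict ?d B = a b"
      using uniq[of b "restrict ?d B"] b BV by (simp add: restrict_PiE_iff subset_iff)
    then have "a b e = restrict ?d B e" by (rule arg_cong[symmetric])
    then show "a b e = (if b = e then \<one>\<^bsub>K\<^esub> else \<zero>\<^bsub>K\<^esub>)" using e by auto
  qed
qed

subsection \<open>A model of the truncated polynomial ring\<close>

text \<open>The triple \<open>(a, b, c)\<close> stands for \<open>a + b x + c y\<close> in \<open>F\<^sub>p[x,y]/(x\<^sup>2,xy,y\<^sup>2)\<close>.\<close>

definition dual_plane :: "nat \<Rightarrow> (int \<times> int \<times> int) ring" where
  "dual_plane p =
    \<lparr>carrier = {0..<int p} \<times> {0..<int p} \<times> {0..<int p},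
     monoid.mult = (\<lambda>(a, b, c) (a', b', c').
       (a * a' mod p, (a * b' + b * a') mod p, (a * c' + c * a') mod p)),
     one = (1, 0, 0), zero = (0, 0, 0),
     add = (\<lambda>(a, b, c) (a', b', c'). ((a + a') mod p, (b + b') mod p, (c + c') mod p))\<rparr>"

lemma dual_plane_simps:
  "carrier (dual_plane p) = {0..<int p} \<times> {0..<int p} \<times> {0..<int p}"
  "(a, b, c) \<otimes>\<^bsub>dual_plane p\<^esub> (a', b', c') =
    (a * a' mod p, (a * b' + b * a') mod p, (a * c' + c * a') mod p)"
  "\<one>\<^bsub>dual_plane p\<^esub> = (1, 0, 0)"
  "\<zero>\<^bsub>dual_plane p\<^esub> = (0, 0, 0)"
  "(a, b, c) \<oplus>\<^bsub>dual_plane p\<^esub> (a', b', c') = ((a + a') mod p, (b + b') mod p, (c + c') mod p)"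
  by (simp_all add: dual_plane_def)

text \<open>Rewriting rules that remove the inner reductions from the coordinates of sums and
  products in \<open>dual_plane\<close>, for each order of the factors that occurs there.\<close>

lemma lincomb_mod_eq:
  fixes m :: int
  shows "(s * (x mod m) + t * (y mod m)) mod m = (s * x + t * y) mod m"
    and "((x mod m) * s + (y mod m) * t) mod m = (s * x + t * y) mod m"
    and "(s * (x mod m) + (y mod m) * t) mod m = (s * x + t * y) mod m"
    and "((x mod m) * s + t * (y mod m)) mod m = (s * x + t * y) mod m"
  by (rule mod_add_cong; simp add: mod_mult_left_eq mod_mult_right_eq mult.commute)+

lemma dual_plane_cring:
  assumes "p > 1"
  shows "cring (dual_plane p)"
proof (rule cringI)
  show "abelian_group (dual_plane p)"
  proof (rule abelian_groupI)
    fix x assume "x \<in> carrier (dual_plane p)"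
    then obtain a b c where x: "x = (a, b, c)" by (cases x)
    show "\<exists>y\<in>carrier (dual_plane p). y \<oplus>\<^bsub>dual_plane p\<^esub> x = \<zero>\<^bsub>dual_plane p\<^esub>"
      using assms by (intro bexI[of _ "((-a) mod p, (-b) mod p, (-c) mod p)"])
        (auto simp: dual_plane_simps x mod_add_left_eq)
  qed (use assms in \<open>auto simp: dual_plane_simps mod_add_left_eq mod_add_right_eq ac_simps\<close>)
  show "comm_monoid (dual_plane p)"
    by (rule comm_monoidI)
      (use assms in \<open>auto simp: dual_plane_simps lincomb_mod_eq mod_add_eq mod_mult_left_eq mod_mult_right_eq, simp_all add: algebra_simps\<close>)
qed (use assms in \<open>auto simp: dual_plane_simps lincomb_mod_eq mod_add_eq mod_mult_left_eq mod_mult_right_eq, simp_all add: algebra_simps\<close>)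

text \<open>The linear part of a product is \<open>a (b', c') + a' (b, c)\<close>, a combination of
  the linear parts of the factors, so every linear condition on \<open>(b, c)\<close> is inherited
  by products.\<close>

lemma subrng_dual_plane_linear:
  fixes s t :: int
  assumes p: "p > 1"
  shows "subrng {(a, b, c) \<in> carrier (dual_plane p). (s * b + t * c) mod int p = 0} (dual_plane p)"
    (is "subrng ?S _")
proof -
  interpret cring "dual_plane p" by (rule dual_plane_cring[OF p])
  have zero: "(s * ((a * b' + b * a') mod int p) + t * ((a * c' + c * a') mod int p)) mod int p = 0"
    if "(s * b + t * c) mod int p = 0" "(s * b' + t * c') mod int p = 0" for a b c a' b' c'
  proof -
    have "(s * ((a * b' + b * a') mod int p) + t * ((a * c' + c * a') mod int p)) mod int p
      = (a * (s * b' + t * c') + a' * (s * b + t * c)) mod int p"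
      by (simp add: lincomb_mod_eq) (simp add: algebra_simps)
    also have "\<dots> = 0" using that by (simp flip: dvd_eq_mod_eq_0)
    finally show ?thesis .
  qed
  \<comment> \<open>A sum of linear parts is the linear part of a product with both constant terms
    equal to 1.\<close>
  have add: "(s * ((b + b') mod int p) + t * ((c + c') mod int p)) mod int p = 0"
    if "(s * b + t * c) mod int p = 0" "(s * b' + t * c') mod int p = 0" for b c b' c'
    using zero[of b c b' c' 1 1] that by (simp add: add.commute)
  have "subgroup ?S (add_monoid (dual_plane p))"
  proof (rule group.subgroupI[OF a_group])
    show "?S \<noteq> {}" using p by (auto simp: dual_plane_simps intro!: exI[of _ 0])
  next
    fix x assume "x \<in> ?S"
    then obtain a b c where x: "x = (a, b, c)" "(a, b, c) \<in> carrier (dual_plane p)"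
      "(s * b + t * c) mod int p = 0" by auto
    have "\<ominus>\<^bsub>dual_plane p\<^esub> x = ((-a) mod p, (-b) mod p, (-c) mod p)"
      using x p by (intro minus_equality) (auto simp: dual_plane_simps mod_add_left_eq)
    moreover have "(s * ((-b) mod p) + t * ((-c) mod p)) mod int p = (- (s * b + t * c)) mod int p"
      by (simp add: lincomb_mod_eq)
    then have "(s * ((-b) mod p) + t * ((-c) mod p)) mod int p = 0"
      using x(3) dvd_minus_iff[of "int p" "s * b + t * c"] by (simp only: dvd_eq_mod_eq_0)
    ultimately show "inv\<^bsub>add_monoid (dual_plane p)\<^esub> x \<in> ?S"
      using p by (simp only: a_inv_def[symmetric]) (simp add: dual_plane_simps)
  next
    fix x y assume "x \<in> ?S" "y \<in> ?S"
    then obtain a b c a' b' c' where "x = (a, b, c)" "y = (a', b', c')"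
      "(s * b + t * c) mod int p = 0" "(s * b' + t * c') mod int p = 0" by (cases x; cases y) auto
    then show "x \<otimes>\<^bsub>add_monoid (dual_plane p)\<^esub> y \<in> ?S"
      using add[of b c b' c'] p by (simp add: dual_plane_simps)
  qed auto
  moreover have "x \<otimes>\<^bsub>dual_plane p\<^esub> y \<in> ?S" if "x \<in> ?S" "y \<in> ?S" for x y
  proof -
    obtain a b c where x: "x = (a, b, c)" by (cases x)
    obtain a' b' c' where y: "y = (a', b', c')" by (cases y)
    show ?thesis using that zero[of b c b' c' a a'] p by (simp add: x y dual_plane_simps)
  qed
  ultimately show ?thesis
    unfolding subrng_def additive_subgroup_def by auto
qed

text \<open>\<open>L s t\<close> is F_p plus the line \<open>s b + t c = 0\<close>. The lines for
  (1, 0) and for (s, 1) with \<open>0 <= s < p\<close> are all lines through the origin of the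
  plane, and every point lies on one of them.\<close>

lemma dual_plane_cover:
  assumes p: "Factorial_Ring.prime p"
  shows "\<exists>\<C>. ring_cover \<C> (dual_plane p) \<and> finite \<C> \<and> card \<C> \<le> p + 1"
proof -
  have p1: "p > 1" using p by (rule prime_gt_1_nat)
  define L where "L s t = {(a, b, c) \<in> carrier (dual_plane p). (s * b + t * c) mod int p = 0}" for s t
  define \<C> where "\<C> = insert (L 1 0) ((\<lambda>s. L s 1) ` {0..<int p})"
  have "proper_subrng (L s t) (dual_plane p)" if "s = 1 \<or> t = 1" for s t
  proof -
    \<comment> \<open>The element x violates the condition if \<open>s = 1\<close>, and y violates
      it if \<open>t = 1\<close>.\<close>
    have "1 mod int p \<noteq> 0" using p1 by simp
    then have "(0, 1, 0) \<notin> L s t \<or> (0, 0, 1) \<notin> L s t" using that by (auto simp: L_def)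
    moreover have "(0, 1, 0) \<in> carrier (dual_plane p)" "(0, 0, 1) \<in> carrier (dual_plane p)"
      using p1 by (auto simp: dual_plane_simps)
    ultimately have "L s t \<noteq> carrier (dual_plane p)" by blast
    then show ?thesis
      using subrng_dual_plane_linear[OF p1, of s t] by (simp add: proper_subrng_def L_def)
  qed
  then have "\<forall>S\<in>\<C>. proper_subrng S (dual_plane p)" by (auto simp: \<C>_def)
  moreover have "\<exists>S\<in>\<C>. (a, b, c) \<in> S" if abc: "(a, b, c) \<in> carrier (dual_plane p)" for a b c
  proof (cases "b = 0")
    case True
    then show ?thesis using abc by (auto simp: \<C>_def L_def)
  next
    case False
    then have "\<not> int p dvd b" using abc zdvd_not_zless[of b "int p"] by (simp add: dual_plane_simps)
    then have "coprime b (int p)"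
      using p prime_imp_coprime[of "int p" b] by (simp add: coprime_commute)
    then obtain i where i: "[b * i = 1] (mod int p)" using cong_solve_coprime_int by blast
    \<comment> \<open>With \<open>i\<close> the inverse of \<open>b\<close> modulo \<open>p\<close>,
      this is the solution of \<open>s b + c = 0\<close>.\<close>
    define s where "s = (- (c * i)) mod int p"
    have "(s * b + 1 * c) mod int p = (- (c * i) * b + 1 * c) mod int p"
      unfolding s_def by (rule mod_add_cong[OF mod_mult_left_eq refl])
    also have "\<dots> = (c - c * (b * i)) mod int p"
      by (simp add: algebra_simps)
    also have "\<dots> = (c - c * 1) mod int p"
      using cong_diff[OF cong_refl cong_mult[OF cong_refl i]] unfolding cong_def by blast
    finally have "(a, b, c) \<in> L s 1" using abc by (simp add: L_def)
    moreover have "s \<in> {0..<int p}" using p1 by (simp add: s_def)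
    ultimately show ?thesis by (auto simp: \<C>_def)
  qed
  then have "carrier (dual_plane p) \<subseteq> \<Union>\<C>" unfolding subset_iff split_paired_All by blast
  moreover have "L s t \<subseteq> carrier (dual_plane p)" for s t by (auto simp: L_def)
  then have "\<Union>\<C> \<subseteq> carrier (dual_plane p)" unfolding \<C>_def by blast
  ultimately have "ring_cover \<C> (dual_plane p)" by (simp add: ring_cover_def subset_antisym)
  moreover have "finite \<C>" by (simp add: \<C>_def)
  moreover have "card \<C> \<le> p + 1"
    unfolding \<C>_def using card_image_le[of "{0..<int p}" "\<lambda>s. L s 1"]
    by (simp add: card_insert_if)
  ultimately show ?thesis by blast
qed

section \<open>Polynomials up to their linear terms\<close>

text \<open>Splits off the constant term: what remains is divisible by the variable, and the
  quotient is the shifted coefficient sequence.\<close>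

lemma (in UP_cring) up_shift:
  assumes f: "f \<in> carrier P"
  shows "(\<lambda>n. f (Suc n)) \<in> carrier P"
    and "f = monom P (f 0) 0 \<oplus>\<^bsub>P\<^esub> monom P \<one> 1 \<otimes>\<^bsub>P\<^esub> (\<lambda>n. f (Suc n))"
proof -
  let ?g = "\<lambda>n. f (Suc n)"
  have fup: "f \<in> up R" using f by (simp add: P_def UP_def)
  obtain n where "bound \<zero> n f" using fup by auto
  then have "bound \<zero> n ?g" by (auto simp: bound_def)
  then have g: "?g \<in> up R" using fup by (auto intro!: mem_upI mem_upD)
  then show gP: "?g \<in> carrier P" by (simp add: P_def UP_def)
  have coeff: "coeff P h k = h k" if "h \<in> carrier P" for h k
    using that by (simp add: P_def UP_def)
  have f0: "f 0 \<in> carrier R" using fup by auto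
  show "f = monom P (f 0) 0 \<oplus>\<^bsub>P\<^esub> monom P \<one> 1 \<otimes>\<^bsub>P\<^esub> ?g"
  proof (rule up_eqI)
    fix k
    show "coeff P f k = coeff P (monom P (f 0) 0 \<oplus>\<^bsub>P\<^esub> monom P \<one> 1 \<otimes>\<^bsub>P\<^esub> ?g) k"
    proof (cases k)
      case 0
      then show ?thesis using f f0 gP by (simp add: coeff[OF f])
    next
      case (Suc m)
      have "coeff P (monom P \<one> 1 \<otimes>\<^bsub>P\<^esub> ?g) (m + 1) = \<one> \<otimes> coeff P ?g m"
        by (rule coeff_monom_mult[OF R.one_closed gP])
      also have "\<dots> = f k" using coeff[OF gP] Suc by (simp add: mem_upD[OF fup])
      finally show ?thesis
        using f f0 gP Suc by (simp add: coeff[OF f] mem_upD[OF fup] del: coeff_mult)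
    qed
  qed (use f f0 gP in auto)
qed

text \<open>The outer index of \<open>f\<close> is the exponent of \<open>y\<close>, the inner one that of \<open>x\<close>.\<close>

definition linear_part :: "(nat \<Rightarrow> nat \<Rightarrow> int) \<Rightarrow> int \<times> int \<times> int" where
  "linear_part f = (f 0 0, f 0 1, f 1 0)"

lemma dual_plane_mult_eq_zero:
  "(0, b, c) \<otimes>\<^bsub>dual_plane p\<^esub> (0, b', c') = \<zero>\<^bsub>dual_plane p\<^esub>"
  by (simp add: dual_plane_simps)

text \<open>The coefficients of 1, x and y in a product depend only on those of the factors, and
  their formula is the multiplication of \<open>dual_plane\<close>. The kernel consists of the
  polynomials without terms of degree below two, and these form the ideal generated by the three
  monomials of degree two.\<close>

lemma linear_part_ring_hom:
  assumes p: "Factorial_Ring.prime p"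
  shows "ring_hom_ring (poly_ring2 p) (dual_plane p) linear_part"
    and "linear_part ` carrier (poly_ring2 p) = carrier (dual_plane p)"
    and "trunc_poly_ring2 p = poly_ring2 p Quot a_kernel (poly_ring2 p) (dual_plane p) linear_part"
proof -
  define F where "F = prime_field p"
  define A where "A = UP F"
  define P where "P = UP A"
  have p1: "p > 1" using p by (rule prime_gt_1_nat)
  interpret F: cring F
    unfolding F_def using p1 by (intro residues.cring) (simp add: residues_def)
  interpret A: UP_cring F A by unfold_locales (simp add: A_def)
  interpret P: UP_cring A P by unfold_locales (simp add: P_def)
  have PP: "poly_ring2 p = P" by (simp add: poly_ring2_def P_def A_def F_def)
  interpret D: cring "dual_plane p" by (rule dual_plane_cring[OF p1])
  have Fs: "carrier F = {0..<int p}" "x \<oplus>\<^bsub>F\<^esub> y = (x + y) mod p" "x \<otimes>\<^bsub>F\<^esub> y = (x * y) mod p"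
    "\<zero>\<^bsub>F\<^esub> = 0" "\<one>\<^bsub>F\<^esub> = 1" for x y
    by (auto simp: F_def residue_ring_def)
  have cP: "coeff P f k = f k" if "f \<in> carrier P" for f k
    using that by (simp add: P_def UP_def)
  have cA: "coeff A f k = f k" if "f \<in> carrier A" for f k
    using that by (simp add: A_def UP_def)
  have Pc: "f k \<in> carrier A" if "f \<in> carrier P" for f k
    using P.coeff_closed[OF that] by (simp add: cP that)
  have Ac: "f k \<in> carrier F" if "f \<in> carrier A" for f k
    using A.coeff_closed[OF that] by (simp add: cA that)
  have addP: "(f \<oplus>\<^bsub>P\<^esub> g) k = f k \<oplus>\<^bsub>A\<^esub> g k" if "f \<in> carrier P" "g \<in> carrier P" for f g k
    using P.coeff_add[OF that, of k] that by (simp add: cP)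
  have addA: "(f \<oplus>\<^bsub>A\<^esub> g) k = f k \<oplus>\<^bsub>F\<^esub> g k" if "f \<in> carrier A" "g \<in> carrier A" for f g k
    using A.coeff_add[OF that, of k] that by (simp add: cA)
  have mP: "(f \<otimes>\<^bsub>P\<^esub> g) 0 = f 0 \<otimes>\<^bsub>A\<^esub> g 0"
    "(f \<otimes>\<^bsub>P\<^esub> g) 1 = f 0 \<otimes>\<^bsub>A\<^esub> g 1 \<oplus>\<^bsub>A\<^esub> f 1 \<otimes>\<^bsub>A\<^esub> g 0" if "f \<in> carrier P" "g \<in> carrier P" for f g
    using P.coeff_mult[OF that, of 0] P.coeff_mult[OF that, of 1] that
    by (simp_all add: cP Pc atMost_Suc A.P.a_comm)
  have mA: "(f \<otimes>\<^bsub>A\<^esub> g) 0 = f 0 \<otimes>\<^bsub>F\<^esub> g 0"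
    "(f \<otimes>\<^bsub>A\<^esub> g) 1 = f 0 \<otimes>\<^bsub>F\<^esub> g 1 \<oplus>\<^bsub>F\<^esub> f 1 \<otimes>\<^bsub>F\<^esub> g 0" if "f \<in> carrier A" "g \<in> carrier A" for f g
    using A.coeff_mult[OF that, of 0] A.coeff_mult[OF that, of 1] that
    by (simp_all add: cA Ac atMost_Suc F.a_comm)
  have moP: "monom P a n k = (if n = k then a else \<zero>\<^bsub>A\<^esub>)" if "a \<in> carrier A" for a n k
    using P.coeff_monom[OF that, of n k] that by (simp add: cP)
  have moA: "monom A a n k = (if n = k then a else \<zero>\<^bsub>F\<^esub>)" if "a \<in> carrier F" for a n k
    using A.coeff_monom[OF that, of n k] that by (simp add: cA)
  have zA: "\<zero>\<^bsub>A\<^esub> k = \<zero>\<^bsub>F\<^esub>" for k using A.coeff_zero[of k] by (simp only: cA[OF A.UP_zero_closed])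
  have oneA: "\<one>\<^bsub>A\<^esub> k = (if k = 0 then \<one>\<^bsub>F\<^esub> else \<zero>\<^bsub>F\<^esub>)" for k
    using A.coeff_one[of k] by (simp only: cA[OF A.UP_one_closed])
  have oneP: "\<one>\<^bsub>P\<^esub> k = (if k = 0 then \<one>\<^bsub>A\<^esub> else \<zero>\<^bsub>A\<^esub>)" for k
    using P.coeff_one[of k] by (simp only: cP[OF P.UP_one_closed])
  have Fmem: "f j k \<in> {0..<int p}" if "f \<in> carrier P" for f j k
    using Ac[OF Pc[OF that]] by (simp add: Fs)
  show hom: "ring_hom_ring (poly_ring2 p) (dual_plane p) linear_part"
    unfolding PP
  proof (rule ring_hom_ringI)
    fix f g assume fg: "f \<in> carrier P" "g \<in> carrier P"
    show "linear_part (f \<oplus>\<^bsub>P\<^esub> g) = linear_part f \<oplus>\<^bsub>dual_plane p\<^esub> linear_part g"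
      using fg Pc by (simp add: linear_part_def addP addA Fs dual_plane_simps)
    show "linear_part (f \<otimes>\<^bsub>P\<^esub> g) = linear_part f \<otimes>\<^bsub>dual_plane p\<^esub> linear_part g"
      using fg Pc
      by (simp add: linear_part_def mP[unfolded One_nat_def] mA[unfolded One_nat_def] addA Fs
          dual_plane_simps mod_add_eq)
  next
    fix f assume "f \<in> carrier P"
    then show "linear_part f \<in> carrier (dual_plane p)"
      using Fmem by (simp add: linear_part_def dual_plane_simps)
  qed (auto simp: linear_part_def dual_plane_simps oneP oneA zA Fs P.P.ring_axioms D.ring_axioms)
  interpret h: ring_hom_ring "poly_ring2 p" "dual_plane p" linear_part by (fact hom)
  show "linear_part ` carrier (poly_ring2 p) = carrier (dual_plane p)"
  proof
    show "carrier (dual_plane p) \<subseteq> linear_part ` carrier (poly_ring2 p)"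
    proof
      fix x assume "x \<in> carrier (dual_plane p)"
      then obtain a b c where x: "x = (a, b, c)" "a \<in> carrier F" "b \<in> carrier F" "c \<in> carrier F"
        by (cases x) (auto simp: dual_plane_simps Fs)
      \<comment> \<open>The polynomial \<open>(a + b x) + c y\<close>.\<close>
      let ?f = "monom P (monom A a 0 \<oplus>\<^bsub>A\<^esub> monom A b 1) 0 \<oplus>\<^bsub>P\<^esub> monom P (monom A c 0) 1"
      have "linear_part ?f = x"
        using x(2-4) by (simp add: linear_part_def addP moP addA moA zA) (simp add: Fs x(1))
      moreover have "?f \<in> carrier P" using x(2-4) by simp
      ultimately show "x \<in> linear_part ` carrier (poly_ring2 p)" unfolding PP by blast
    qed
  qed (use h.hom_closed in blast)
  define X where "X = monom A \<one>\<^bsub>F\<^esub> 1"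
  define x where "x = monom P X 0"
  define y where "y = monom P \<one>\<^bsub>A\<^esub> 1"
  have xy: "var_x p = x" "var_y p = y"
    by (simp_all add: var_x_def var_y_def PP x_def y_def X_def A_def[symmetric] F_def[symmetric])
  have XA: "X \<in> carrier A" by (simp add: X_def)
  have xP: "x \<in> carrier P" "y \<in> carrier P" using XA by (simp_all add: x_def y_def)
  let ?G = "{x \<otimes>\<^bsub>P\<^esub> x, x \<otimes>\<^bsub>P\<^esub> y, y \<otimes>\<^bsub>P\<^esub> y}"
  let ?K = "a_kernel P (dual_plane p) linear_part"
  have GP: "?G \<subseteq> carrier P" using xP by auto
  interpret I: ideal "Idl\<^bsub>P\<^esub> ?G" P by (rule P.P.genideal_ideal[OF GP])
  have lp: "linear_part x = (0, 1, 0)" "linear_part y = (0, 0, 1)"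
    using XA moA[OF F.one_closed] by (simp_all add: linear_part_def x_def y_def moP X_def zA oneA Fs)
  have "u \<otimes>\<^bsub>P\<^esub> v \<in> ?K" if "u \<in> {x, y}" "v \<in> {x, y}" for u v
  proof -
    have uv: "u \<in> carrier P" "v \<in> carrier P" using that xP by auto
    have "linear_part (u \<otimes>\<^bsub>P\<^esub> v) = linear_part u \<otimes>\<^bsub>dual_plane p\<^esub> linear_part v"
      by (rule h.hom_mult[unfolded PP, OF uv])
    also have "\<dots> = \<zero>\<^bsub>dual_plane p\<^esub>"
    proof -
      have "\<exists>b c. linear_part u = (0, b, c)" "\<exists>b c. linear_part v = (0, b, c)"
        using that lp by blast+
      then show ?thesis using dual_plane_mult_eq_zero by metis
    qed
    finally show ?thesis using P.UP_mult_closed[OF uv] unfolding a_kernel_def' by blast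
  qed
  then have "?G \<subseteq> ?K" by blast
  then have "Idl\<^bsub>P\<^esub> ?G \<subseteq> ?K"
    using h.kernel_is_ideal unfolding PP by (intro P.P.genideal_minimal)
  \<comment> \<open>For \<open>f\<close> in the kernel, the coefficient of \<open>y^0\<close> is
    divisible by \<open>x^2\<close> and that of \<open>y^1\<close> by \<open>x\<close>; the
    remaining terms are divisible by \<open>y^2\<close>.\<close>
  moreover have "?K \<subseteq> Idl\<^bsub>P\<^esub> ?G"
  proof
    fix f assume "f \<in> ?K"
    then have f: "f \<in> carrier P" and f0: "f 0 0 = 0" "f 0 1 = 0" "f 1 0 = 0"
      by (auto simp: a_kernel_def' linear_part_def dual_plane_simps)
    have G: "a \<otimes>\<^bsub>P\<^esub> b \<otimes>\<^bsub>P\<^esub> g \<in> Idl\<^bsub>P\<^esub> ?G" if "a \<otimes>\<^bsub>P\<^esub> b \<in> ?G" "g \<in> carrier P" for a b g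
      using that P.P.genideal_self[OF GP] by (intro I.I_r_closed[OF subsetD])
    \<comment> \<open>The constant term of the quotient is the linear coefficient of
      \<open>a\<close>, so the division can be repeated if that vanishes too.\<close>
    have div_X: "\<exists>b\<in>carrier A. a = X \<otimes>\<^bsub>A\<^esub> b \<and> b 0 = a 1" if "a \<in> carrier A" "a 0 = 0" for a
      using A.up_shift[OF that(1)] that by (intro bexI[of _ "\<lambda>n. a (Suc n)"]) (simp_all add: X_def Fs(4)[symmetric])
    obtain b where b: "b \<in> carrier A" "f 0 = X \<otimes>\<^bsub>A\<^esub> b" "b 0 = 0"
      using div_X[OF Pc[OF f, of 0]] f0 by auto
    obtain c where c: "c \<in> carrier A" "b = X \<otimes>\<^bsub>A\<^esub> c" using div_X[OF b(1,3)] by auto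
    obtain d where d: "d \<in> carrier A" "f 1 = X \<otimes>\<^bsub>A\<^esub> d" using div_X[OF Pc[OF f, of 1]] f0 by auto
    \<comment> \<open>Shifting twice gives \<open>f = f 0 + y (f 1 + y k)\<close>.\<close>
    define g where "g = (\<lambda>n. f (Suc n))"
    define k where "k = (\<lambda>n. g (Suc n))"
    have g: "g \<in> carrier P" "f = monom P (f 0) 0 \<oplus>\<^bsub>P\<^esub> y \<otimes>\<^bsub>P\<^esub> g"
      unfolding g_def y_def using P.up_shift[OF f] by auto
    have k: "k \<in> carrier P" "g = monom P (g 0) 0 \<oplus>\<^bsub>P\<^esub> y \<otimes>\<^bsub>P\<^esub> k"
      unfolding k_def y_def using P.up_shift[OF g(1)] by auto
    have const: "monom P (a \<otimes>\<^bsub>A\<^esub> b) 0 = monom P a 0 \<otimes>\<^bsub>P\<^esub> monom P b 0"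
      if "a \<in> carrier A" "b \<in> carrier A" for a b
      using P.monom_mult[OF that, of 0 0] by simp
    have "monom P (f 0) 0 = x \<otimes>\<^bsub>P\<^esub> x \<otimes>\<^bsub>P\<^esub> monom P c 0"
      using XA c(1) by (simp add: b(2) c(2) const x_def P.P.m_assoc)
    moreover have "monom P (g 0) 0 = x \<otimes>\<^bsub>P\<^esub> monom P d 0"
      using XA d by (simp add: g_def const x_def)
    then have "y \<otimes>\<^bsub>P\<^esub> g = x \<otimes>\<^bsub>P\<^esub> y \<otimes>\<^bsub>P\<^esub> monom P d 0 \<oplus>\<^bsub>P\<^esub> y \<otimes>\<^bsub>P\<^esub> y \<otimes>\<^bsub>P\<^esub> k"
      using k xP d(1) by (subst k(2)) (simp add: P.P.r_distr P.P.m_ac)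
    ultimately have "f = x \<otimes>\<^bsub>P\<^esub> x \<otimes>\<^bsub>P\<^esub> monom P c 0 \<oplus>\<^bsub>P\<^esub>
        (x \<otimes>\<^bsub>P\<^esub> y \<otimes>\<^bsub>P\<^esub> monom P d 0 \<oplus>\<^bsub>P\<^esub> y \<otimes>\<^bsub>P\<^esub> y \<otimes>\<^bsub>P\<^esub> k)"
      using g(2) by simp
    also have "\<dots> \<in> Idl\<^bsub>P\<^esub> ?G" using c d k by (intro I.a_closed G) auto
    finally show "f \<in> Idl\<^bsub>P\<^esub> ?G" .
  qed
  ultimately show "trunc_poly_ring2 p = poly_ring2 p Quot a_kernel (poly_ring2 p) (dual_plane p) linear_part"
    unfolding trunc_poly_ring2_def xy PP by simp
qed

text \<open>First isomorphism theorem for \<open>linear_part\<close>. The ring property is recorded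
  along with it because reversing the isomorphism calls for it.\<close>

lemma trunc_poly_ring2_iso:
  assumes "Factorial_Ring.prime p"
  shows "ring (trunc_poly_ring2 p)" and "trunc_poly_ring2 p \<simeq> dual_plane p"
proof -
  interpret ring_hom_ring "poly_ring2 p" "dual_plane p" linear_part
    by (rule linear_part_ring_hom[OF assms])
  show "ring (trunc_poly_ring2 p)"
    unfolding linear_part_ring_hom(3)[OF assms] by (rule ideal.quotient_is_ring[OF kernel_is_ideal])
  show "trunc_poly_ring2 p \<simeq> dual_plane p"
    unfolding linear_part_ring_hom(3)[OF assms] by (rule FactRing_iso[OF linear_part_ring_hom(2)[OF assms]])
qed

subsection \<open>Covers\<close>

lemma covering_number_le:
  assumes "ring_cover \<C> R" and "finite \<C>"
  shows "covering_number R \<le> enat (card \<C>)"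
  unfolding covering_number_def using assms by (intro Inf_lower) blast

lemma covering_number_ge:
  assumes "\<And>\<C>. \<lbrakk>ring_cover \<C> R; finite \<C>\<rbrakk> \<Longrightarrow> k \<le> card \<C>"
  shows "enat k \<le> covering_number R"
  unfolding covering_number_def using assms by (intro Inf_greatest) auto

lemma covering_number_not_coverable:
  assumes "\<not> coverable R"
  shows "covering_number R = \<infinity>"
  using assms by (simp add: covering_number_def coverable_def top_enat_def)

lemma (in ring_hom_ring) subrng_vimage:
  assumes "subrng T S"
  shows "subrng {r \<in> carrier R. h r \<in> T} R"
proof -
  interpret T: additive_subgroup T S using assms by (simp add: subrng_def)
  have "subgroup {r \<in> carrier R. h r \<in> T} (add_monoid R)"
    by (rule group.subgroupI[OF R.a_group])
      (auto simp: a_inv_def[symmetric] T.a_closed intro!: exI[of _ "\<zero>"])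
  then show ?thesis
    using assms by (auto simp: subrng_def additive_subgroup_def)
qed

text \<open>Surjectivity keeps the preimages proper: if the preimage of \<open>T\<close> were all of
  \<open>R\<close>, then \<open>T\<close> would contain the whole image.\<close>

lemma (in ring_hom_ring) ring_cover_vimage:
  assumes surj: "h ` carrier R = carrier S" and cover: "ring_cover \<C> S"
  shows "ring_cover ((\<lambda>T. {r \<in> carrier R. h r \<in> T}) ` \<C>) R"
proof -
  have "{r \<in> carrier R. h r \<in> T} \<noteq> carrier R" if "T \<in> \<C>" for T
  proof
    assume eq: "{r \<in> carrier R. h r \<in> T} = carrier R"
    have "h ` {r \<in> carrier R. h r \<in> T} \<subseteq> T" by blast
    then have "carrier S \<subseteq> T" unfolding eq surj .
    moreover have "T \<subseteq> carrier S" using that cover by (auto simp: ring_cover_def)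
    ultimately show False using that cover by (auto simp: ring_cover_def proper_subrng_def)
  qed
  then have "\<forall>T\<in>\<C>. proper_subrng {r \<in> carrier R. h r \<in> T} R"
    using cover subrng_vimage by (auto simp: ring_cover_def proper_subrng_def)
  moreover have "\<exists>T\<in>\<C>. h r \<in> T" if "r \<in> carrier R" for r
    using hom_closed[OF that] cover by (auto simp: ring_cover_def)
  ultimately show ?thesis unfolding ring_cover_def by auto
qed

lemma (in ring_hom_ring) covering_number_le_of_surj:
  assumes surj: "h ` carrier R = carrier S" and cover: "ring_cover \<C> S" "finite \<C>"
  shows "coverable R" and "covering_number R \<le> enat (card \<C>)"
proof -
  note C = ring_cover_vimage[OF surj cover(1)]
  then show "coverable R" by (auto simp: coverable_def)
  have "covering_number R \<le> enat (card ((\<lambda>T. {r \<in> carrier R. h r \<in> T}) ` \<C>))"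
    using cover(2) by (intro covering_number_le[OF C]) auto
  also have "\<dots> \<le> enat (card \<C>)" using cover(2) by (simp add: card_image_le)
  finally show "covering_number R \<le> enat (card \<C>)" .
qed

lemma subrng_add_pow_closed:
  assumes "subrng S R" and "ring R" and "x \<in> S"
  shows "add_pow R (k :: nat) x \<in> S"
proof -
  interpret ring R by fact
  interpret additive_subgroup S R using assms by (simp add: subrng_def)
  show ?thesis using assms(3) by (induction k) (auto simp: zero_closed a_closed)
qed

subsection \<open>Finite local rings with prime residue field\<close>

text \<open>The map \<open>g\<close> is reduction modulo \<open>J\<close> followed by an
  identification of the residue field with F_p, with values among 0, ..., p - 1. Locality enters in
  the form that elements outside \<open>J\<close> are units.\<close>

locale prime_local_ring = cring R for R (structure) +
  fixes p :: nat and J :: "'a set" and g :: "'a \<Rightarrow> int"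
  assumes prime: "Factorial_Ring.prime p"
    and fin: "finite (carrier R)"
    and J_ideal: "ideal J R"
    and unitI: "\<lbrakk>x \<in> carrier R; x \<notin> J\<rbrakk> \<Longrightarrow> x \<in> Units R"
    and g_hom: "g \<in> ring_hom R (prime_field p)"
    and g_eq_0_iff: "x \<in> carrier R \<Longrightarrow> g x = 0 \<longleftrightarrow> x \<in> J"
begin

sublocale J: ideal J R by (rule J_ideal)

sublocale JJ: ideal "J \<cdot> J" R by (rule ideal_prod_is_ideal[OF J_ideal J_ideal])

lemma p_gt_1: "p > 1" using prime by (rule prime_gt_1_nat)

lemma
  assumes "x \<in> carrier R" "y \<in> carrier R"
  shows g_range: "0 \<le> g x" "g x < int p"
    and g_add: "g (x \<oplus> y) = (g x + g y) mod int p"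
    and g_mult: "g (x \<otimes> y) = (g x * g y) mod int p"
  using ring_hom_closed[OF g_hom] ring_hom_add[OF g_hom] ring_hom_mult[OF g_hom] assms p_gt_1
  by (auto simp: residue_ring_def)

lemma g_one: "g \<one> = 1" and g_zero: "g \<zero> = 0"
  using ring_hom_one[OF g_hom] g_eq_0_iff by (auto simp: residue_ring_def)

lemma g_of_nat: "g ([k] \<cdot> \<one>) = int k mod int p"
  by (induction k) (simp_all add: g_add g_zero g_one mod_add_left_eq mod_add_right_eq add.commute)

lemma p_mem: "[p] \<cdot> \<one> \<in> J"
  using g_eq_0_iff[of "[p] \<cdot> \<one>"] by (simp add: g_of_nat)

lemma one_minus_unit:
  assumes "j \<in> J"
  shows "\<one> \<ominus> j \<in> Units R"
proof (rule unitI)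
  show "\<one> \<ominus> j \<notin> J"
  proof
    assume "\<one> \<ominus> j \<in> J"
    then have "(\<one> \<ominus> j) \<oplus> j \<in> J" using assms by (rule J.a_closed)
    moreover have "(\<one> \<ominus> j) \<oplus> j = \<one>" using assms J.a_Hcarr by (simp add: minus_eq a_assoc l_neg)
    ultimately show False using g_eq_0_iff[of \<one>] g_one by simp
  qed
qed (use assms J.a_Hcarr in auto)

text \<open>Subtracting from \<open>r\<close> the multiple of 1 given by the representative
  \<open>g r\<close> leaves an element that \<open>g\<close> kills.\<close>

lemma decompose:
  assumes "r \<in> carrier R"
  obtains k :: nat and j where "j \<in> J" and "r = [k] \<cdot> \<one> \<oplus> j"
proof
  let ?j = "r \<ominus> [nat (g r)] \<cdot> \<one>"
  show r: "r = [nat (g r)] \<cdot> \<one> \<oplus> ?j"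
    using assms by (simp add: minus_eq a_lcomm r_neg)
  have "g r = (int (nat (g r)) mod int p + g ?j) mod int p"
    using g_add[of "[nat (g r)] \<cdot> \<one>" ?j] r assms by (simp add: g_of_nat)
  then have "g r = (g r + g ?j) mod int p" using g_range[OF assms assms] by simp
  then have "(g r + g ?j) mod int p = g r mod int p" using g_range[OF assms assms] by simp
  then have "int p dvd g ?j" by (simp add: mod_eq_dvd_iff)
  moreover have "0 \<le> g ?j" "g ?j < int p" using g_range[of ?j ?j] assms by auto
  ultimately have "g ?j = 0" by (metis mod_pos_pos_trivial dvd_imp_mod_0)
  then show "?j \<in> J" using g_eq_0_iff assms by simp
qed

text \<open>Noetherian induction along the principal ideals: \<open>a R\<close> strictly contains \<open>a j R\<close> for
  \<open>a \<noteq> \<zero>\<close> and \<open>j \<in> J\<close>. It replaces the nilpotency of \<open>J\<close>.\<close>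

lemma J_induct [consumes 1, case_names zero step]:
  assumes "a \<in> carrier R" and zero: "P \<zero>"
    and step: "\<And>a. \<lbrakk>a \<in> carrier R; \<And>j. j \<in> J \<Longrightarrow> P (a \<otimes> j)\<rbrakk> \<Longrightarrow> P a"
  shows "P a"
  using assms(1)
proof (induction "card ((\<lambda>r. a \<otimes> r) ` carrier R)" arbitrary: a rule: less_induct)
  case less
  show ?case
  proof (cases "a = \<zero>")
    case False
    have "P (a \<otimes> j)" if j: "j \<in> J" for j
    proof (rule less.hyps)
      have jR: "j \<in> carrier R" using j by (rule J.a_Hcarr)
      then show "a \<otimes> j \<in> carrier R" using less.prems by simp
      have "a \<notin> (\<lambda>r. a \<otimes> j \<otimes> r) ` carrier R"
      proof
        assume "a \<in> (\<lambda>r. a \<otimes> j \<otimes> r) ` carrier R"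
        then obtain r where r: "r \<in> carrier R" "a = a \<otimes> j \<otimes> r" by auto
        \<comment> \<open>If \<open>a = a j r\<close>, then \<open>a (1 - j r) = 0\<close> with a
          unit as second factor, which forces \<open>a = 0\<close>.\<close>
        have u: "\<one> \<ominus> j \<otimes> r \<in> Units R" using j r J.I_r_closed by (intro one_minus_unit) auto
        have "a \<otimes> (\<one> \<ominus> j \<otimes> r) = a \<ominus> a \<otimes> j \<otimes> r"
          using less.prems jR r(1) by (simp add: minus_eq r_distr r_minus m_assoc)
        also have "\<dots> = \<zero>" using less.prems r by (simp add: minus_eq r_neg)
        finally have "(\<one> \<ominus> j \<otimes> r) \<otimes> a = (\<one> \<ominus> j \<otimes> r) \<otimes> \<zero>"
          using less.prems jR r(1) by (simp add: m_comm)
        then have "a = \<zero>" using Units_l_cancel[OF u less.prems zero_closed] by simp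
        then show False using False by simp
      qed
      moreover have "a \<in> (\<lambda>r. a \<otimes> r) ` carrier R" using less.prems by (intro image_eqI[of _ _ \<one>]) auto
      moreover have "(\<lambda>r. a \<otimes> j \<otimes> r) ` carrier R \<subseteq> (\<lambda>r. a \<otimes> r) ` carrier R"
        using less.prems jR by (auto simp: m_assoc)
      ultimately have "(\<lambda>r. a \<otimes> j \<otimes> r) ` carrier R \<subset> (\<lambda>r. a \<otimes> r) ` carrier R" by blast
      then show "card ((\<lambda>r. a \<otimes> j \<otimes> r) ` carrier R) < card ((\<lambda>r. a \<otimes> r) ` carrier R)"
        using fin by (intro psubset_card_mono) auto
    qed
    then show ?thesis using step less.prems by simp
  qed (use zero in simp)
qed

section \<open>Nakayama's lemma and generation of the ring by one unit\<close>

text \<open>By \<open>J_induct\<close> on \<open>a\<close>, the product \<open>a j\<close> lies in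
  \<open>I\<close> for all \<open>j\<close> in \<open>J\<close>. Modulo \<open>I\<close> one may
  take \<open>j\<close> in \<open>J^2\<close>, hence a product \<open>j j'\<close>, and
  \<open>a (j j') = (a j) j'\<close> falls under the induction hypothesis for \<open>a j\<close>.
  The case \<open>a = 1\<close> is the claim.\<close>

lemma nakayama:
  assumes I: "ideal I R" and J: "\<And>j. j \<in> J \<Longrightarrow> \<exists>i\<in>I. \<exists>s\<in>J \<cdot> J. j = i \<oplus> s"
  shows "J \<subseteq> I"
proof -
  interpret I: ideal I R by fact
  have "a \<otimes> j \<in> I" if a: "a \<in> carrier R" and j: "j \<in> J" for a j
    using a j
  proof (induction a arbitrary: j rule: J_induct)
    case zero
    then show ?case using J.a_Hcarr by (simp add: I.zero_closed)
  next
    case (step a)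
    obtain i s where s: "i \<in> I" "s \<in> J \<cdot> J" "j = i \<oplus> s" using J step.prems by blast
    have "a \<otimes> s \<in> I" using s(2)
    proof (induction s rule: ideal_prod.induct)
      case (prod j j')
      then show ?case using step J.a_Hcarr by (simp flip: m_assoc)
    next
      case (sum s s')
      then show ?case using step(1) JJ.a_Hcarr by (simp add: r_distr I.a_closed)
    qed
    then show ?case
      using s step(1) JJ.a_Hcarr I.a_Hcarr by (simp add: r_distr I.a_closed I.I_l_closed)
  qed
  from this[of \<one>] show ?thesis using J.a_Hcarr by auto
qed

text \<open>By \<open>J_induct\<close> on \<open>s\<close>, membership of \<open>s\<close> in
  \<open>S\<close> implies that all multiples of \<open>s\<close> lie in \<open>S\<close>; the case
  \<open>s = 1\<close> is the claim. Nakayama's lemma needs an ideal, so it is applied not to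
  \<open>S\<close> but to an auxiliary ideal attached to \<open>s\<close>.\<close>

lemma subrng_eq_carrier:
  assumes S: "subrng S R" and one: "\<one> \<in> S"
    and gen: "\<And>j. j \<in> J \<Longrightarrow> \<exists>s\<in>S \<inter> J. \<exists>t\<in>J \<cdot> J. j = s \<oplus> t"
  shows "S = carrier R"
proof
  interpret S: additive_subgroup S R using S by (simp add: subrng_def)
  have S_mult: "x \<otimes> y \<in> S" if "x \<in> S" "y \<in> S" for x y using S that by (simp add: subrng_def)
  show "S \<subseteq> carrier R" by (rule S.a_subset)
  have "s \<in> S \<longrightarrow> (\<forall>r\<in>carrier R. s \<otimes> r \<in> S)" if "s \<in> carrier R" for s
    using that
  proof (induction s rule: J_induct)
    case zero
    then show ?case by (simp add: S.zero_closed)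
  next
    case (step s)
    show ?case
    proof (intro impI ballI)
      fix r assume s: "s \<in> S" and r: "r \<in> carrier R"
      \<comment> \<open>The largest ideal whose product with \<open>s\<close> stays in
        \<open>S\<close>. It contains \<open>S \<inter> J\<close>: for \<open>k\<close> there,
        \<open>s k\<close> is in \<open>S\<close>, and the induction hypothesis for
        \<open>s k\<close> puts its multiples in \<open>S\<close>. Hence it contains
        \<open>J\<close>, and writing \<open>r = k 1 + j\<close> gives \<open>s r\<close> in
        \<open>S\<close>.\<close>
      let ?K = "{k \<in> carrier R. \<forall>r\<in>carrier R. s \<otimes> k \<otimes> r \<in> S}"
      have "ideal ?K R"
      proof (rule idealI)
        show "subgroup ?K (add_monoid R)"
        proof (rule group.subgroupI[OF a_group])
          show "?K \<noteq> {}" using step(1) S.zero_closed by (auto intro!: exI[of _ \<zero>])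
        qed (use step(1) in \<open>auto simp: a_inv_def[symmetric] r_minus l_minus r_distr l_distr
            intro: S.a_closed S.a_inv_closed\<close>)
        show "x \<otimes> k \<in> ?K" if "k \<in> ?K" "x \<in> carrier R" for k x
        proof -
          have "s \<otimes> (x \<otimes> k) \<otimes> r = s \<otimes> k \<otimes> (x \<otimes> r)" if "r \<in> carrier R" for r
            using that \<open>k \<in> ?K\<close> \<open>x \<in> carrier R\<close> step(1) by (simp add: m_ac)
          then show ?thesis using that by auto
        qed
        then show "k \<otimes> x \<in> ?K" if "k \<in> ?K" "x \<in> carrier R" for k x
          using that m_comm[of k x] by auto
      qed (rule ring_axioms)
      moreover have "S \<inter> J \<subseteq> ?K"
      proof
        fix k assume k: "k \<in> S \<inter> J"
        then have "s \<otimes> k \<in> S" using s S_mult by blast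
        then show "k \<in> ?K" using step(2)[of k] k J.a_Hcarr by blast
      qed
      then have "\<exists>i\<in>?K. \<exists>t\<in>J \<cdot> J. j = i \<oplus> t" if "j \<in> J" for j
        using gen[OF that] by blast
      ultimately have JK: "J \<subseteq> ?K" by (intro nakayama)
      obtain k j where kj: "j \<in> J" "r = [(k::nat)] \<cdot> \<one> \<oplus> j" using decompose[OF r] by blast
      have "s \<otimes> [k] \<cdot> \<one> \<in> S"
        using s one by (intro S_mult subrng_add_pow_closed[OF S ring_axioms]) auto
      moreover have "s \<otimes> j \<otimes> \<one> \<in> S" using JK kj(1) by auto
      then have "s \<otimes> j \<in> S" using step(1) kj(1) J.a_Hcarr by simp
      ultimately show "s \<otimes> r \<in> S"
        using step(1) kj J.a_Hcarr by (simp add: r_distr S.a_closed)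
    qed
  qed
  from this[of \<one>] show "carrier R \<subseteq> S" using one by auto
qed

text \<open>The exponent is positive because a subring without identity may miss the zeroth
  power.\<close>

lemma subrng_power_closed:
  assumes "subrng S R" and "x \<in> S"
  shows "x [^] Suc k \<in> S"
proof -
  have "x \<in> carrier R" using assms additive_subgroup.a_Hcarr by (auto simp: subrng_def)
  then show ?thesis using assms by (induction k) (auto simp: subrng_def)
qed

text \<open>The order of the finite group of units is a positive exponent that takes
  \<open>x\<close> to 1.\<close>

lemma subrng_unit_one:
  assumes S: "subrng S R" and x: "x \<in> S" "x \<in> Units R"
  shows "\<one> \<in> S"
proof -
  interpret U: group "units_of R" by (rule units_group)
  have "finite (Units R)" using fin by (rule rev_finite_subset) auto
  then have "order (units_of R) > 0"
    using U.order_gt_0_iff_finite by (simp add: units_of_carrier)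
  then obtain k where k: "order (units_of R) = Suc k" using gr0_implies_Suc by blast
  have "x [^]\<^bsub>units_of R\<^esub> order (units_of R) = \<one>\<^bsub>units_of R\<^esub>"
    using x by (intro U.pow_order_eq_1) (simp add: units_of_carrier)
  then have "x [^] Suc k = \<one>" using x k units_of_pow[of x] by (simp add: units_of_one units_of_mult)
  then show ?thesis using subrng_power_closed[OF S x(1), of k] by simp
qed

text \<open>Premise \<open>gen\<close> says that every subring containing \<open>x\<close> and
  \<open>p 1\<close> meets \<open>J\<close> in a set that exhausts \<open>J\<close> modulo
  \<open>J^2\<close>. The member of a cover that contains the unit \<open>1 + x\<close> contains 1,
  hence also \<open>x\<close> and \<open>p 1\<close>, and so is everything.\<close>

lemma not_coverable:
  assumes x: "x \<in> J"
    and gen: "\<And>j S. \<lbrakk>j \<in> J; subrng S R; x \<in> S; [p] \<cdot> \<one> \<in> S\<rbrakk> \<Longrightarrow> \<exists>s\<in>S \<inter> J. \<exists>t\<in>J \<cdot> J. j = s \<oplus> t"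
  shows "\<not> coverable R"
proof
  assume "coverable R"
  then obtain \<C> where C: "ring_cover \<C> R" by (auto simp: coverable_def)
  have xR: "x \<in> carrier R" using x by (rule J.a_Hcarr)
  have u: "\<one> \<oplus> x \<in> Units R"
    using one_minus_unit[of "\<ominus> x"] x xR J.a_inv_closed by (simp add: minus_eq)
  then obtain S where S: "S \<in> \<C>" "\<one> \<oplus> x \<in> S"
    using C unfolding ring_cover_def by (metis UnionE Units_closed)
  then have sub: "subrng S R" and ne: "S \<noteq> carrier R"
    using C by (auto simp: ring_cover_def proper_subrng_def)
  interpret S: additive_subgroup S R using sub by (simp add: subrng_def)
  have one: "\<one> \<in> S" by (rule subrng_unit_one[OF sub S(2) u])
  have "(\<ominus> \<one>) \<oplus> (\<one> \<oplus> x) \<in> S" by (rule S.a_closed[OF S.a_inv_closed[OF one] S(2)])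
  then have "x \<in> S" using xR by (simp add: r_neg1 r_neg2)
  moreover have "[p] \<cdot> \<one> \<in> S" by (rule subrng_add_pow_closed[OF sub ring_axioms one])
  ultimately have "S = carrier R" using gen sub by (intro subrng_eq_carrier[OF sub one]) auto
  then show False using ne by simp
qed

section \<open>The lower bound for covers\<close>

text \<open>If the additive index \<open>d\<close> of \<open>S\<close> were below \<open>p\<close>,
  then \<open>d 1\<close> would be a unit and every element a \<open>d\<close>-fold sum. The
  quotient group has order \<open>d\<close>, so such sums lie in \<open>S\<close>, and
  \<open>S\<close> would not be proper.\<close>

lemma proper_subrng_card:
  assumes "proper_subrng S R"
  shows "p * card S \<le> card (carrier R)"
proof -
  interpret S: additive_subgroup S R using assms by (simp add: proper_subrng_def subrng_def)
  let ?G = "add_monoid R"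
  have sub: "subgroup S ?G" by (rule S.a_subgroup)
  interpret N: normal S ?G by (rule comm_group.subgroup_imp_normal[OF a_comm_group sub])
  interpret Q: group "?G Mod S" by (rule N.factorgroup_is_group)
  let ?d = "card (rcosets\<^bsub>?G\<^esub> S)"
  have lag: "?d * card S = card (carrier R)"
    using group.lagrange[OF a_group sub] by (simp add: order_def)
  have "p \<le> ?d"
  proof (rule ccontr)
    assume "\<not> p \<le> ?d"
    then have d: "?d < p" by simp
    have "?d > 0" using lag fin by (metis card_gt_0_iff empty_iff mult_0 not_gr_zero one_closed)
    with d have "g ([?d] \<cdot> \<one>) \<noteq> 0" by (simp add: g_of_nat)
    then have "[?d] \<cdot> \<one> \<in> Units R" using g_eq_0_iff by (intro unitI) auto
    then obtain v where v: "v \<in> carrier R" "[?d] \<cdot> \<one> \<otimes> v = \<one>"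
      using Units_r_inv Units_inv_closed by blast
    have "r \<in> S" if r: "r \<in> carrier R" for r
    proof -
      \<comment> \<open>The element whose \<open>d\<close>-fold sum is \<open>r\<close>.\<close>
      let ?w = "v \<otimes> r"
      have w: "?w \<in> carrier ?G" using v r by simp
      have "[?d] \<cdot> ?w = [?d] \<cdot> v \<otimes> r"
        using v r by (intro add_pow_ldistr[symmetric])
      also have "[?d] \<cdot> v = \<one>" using v add_pow_ldistr[of \<one> v ?d] by simp
      also have "\<one> \<otimes> r = r" using r by simp
      finally have r_eq: "?w [^]\<^bsub>?G\<^esub> ?d = r" by (simp add: add_pow_def)
      have "(S #>\<^bsub>?G\<^esub> ?w) [^]\<^bsub>?G Mod S\<^esub> ?d = \<one>\<^bsub>?G Mod S\<^esub>"
        using Q.pow_order_eq_1[of "S #>\<^bsub>?G\<^esub> ?w"] w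
        by (simp add: order_def FactGroup_def RCOSETS_def) blast
      then have "S #>\<^bsub>?G\<^esub> r = S"
        using N.FactGroup_pow[OF w] r_eq by (simp add: FactGroup_def)
      then show "r \<in> S" using group.rcos_self[OF a_group, of r S] sub r by auto
    qed
    then have "S = carrier R" using S.a_subset by auto
    then show False using assms by (simp add: proper_subrng_def)
  qed
  then have "p * card S \<le> ?d * card S" by simp
  then show ?thesis using lag by simp
qed

text \<open>Counting nonzero elements: each member has at most \<open>N / p - 1\<close> of them, so
  \<open>p\<close> members reach at most \<open>N - p\<close>, short of the \<open>N - 1\<close> in
  \<open>R\<close>.\<close>

lemma cover_card_ge:
  assumes C: "ring_cover \<C> R" and finC: "finite \<C>"
  shows "p + 1 \<le> card \<C>"
proof (rule ccontr)
  assume "\<not> p + 1 \<le> card \<C>"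
  then have c: "card \<C> \<le> p" by simp
  let ?N = "card (carrier R)"
  have S0: "\<zero> \<in> S" "S \<subseteq> carrier R" if "S \<in> \<C>" for S
  proof -
    interpret additive_subgroup S R using C that by (simp add: ring_cover_def proper_subrng_def subrng_def)
    show "\<zero> \<in> S" "S \<subseteq> carrier R" by (auto simp: zero_closed a_Hcarr)
  qed
  have pS: "p * card S \<le> ?N" if "S \<in> \<C>" for S
    using C that by (intro proper_subrng_card) (simp add: ring_cover_def)
  obtain S where S: "S \<in> \<C>" using C one_closed by (auto simp: ring_cover_def)
  have "card S > 0" using S0[OF S] fin by (metis card_gt_0_iff empty_iff finite_subset)
  \<comment> \<open>Keeps the truncated subtraction \<open>N - p\<close> honest in the final
    comparison.\<close>
  then have pN: "p \<le> ?N" using pS[OF S] by (metis One_nat_def Suc_leI le_trans mult.right_neutral mult_le_mono2)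
  have "carrier R - {\<zero>} = (\<Union>S\<in>\<C>. S - {\<zero>})" using C by (auto simp: ring_cover_def)
  then have "card (carrier R - {\<zero>}) \<le> (\<Sum>S\<in>\<C>. card (S - {\<zero>}))"
    using card_UN_le[OF finC, of "\<lambda>S. S - {\<zero>}"] by simp
  \<comment> \<open>Multiplying by \<open>p\<close> avoids the division in the bound for each
    member.\<close>
  then have "p * (?N - 1) \<le> p * (\<Sum>S\<in>\<C>. card (S - {\<zero>}))" using fin by simp
  also have "\<dots> = (\<Sum>S\<in>\<C>. p * card (S - {\<zero>}))" by (rule sum_distrib_left)
  also have "\<dots> \<le> (\<Sum>S\<in>\<C>. ?N - p)"
  proof (rule sum_mono)
    fix S assume S: "S \<in> \<C>"
    have "card (S - {\<zero>}) = card S - 1" using S0[OF S] by simp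
    then show "p * card (S - {\<zero>}) \<le> ?N - p" using pS[OF S] by (simp add: diff_mult_distrib2)
  qed
  also have "\<dots> \<le> p * (?N - p)" using c by simp
  finally have "?N - 1 \<le> ?N - p" using p_gt_1 by simp
  then show False using pN p_gt_1 by linarith
qed

end

subsection \<open>The cotangent space\<close>

lemma subset_singleton_of_card_le_1:
  assumes "finite X" "card X \<le> 1" "X \<subseteq> A" "a \<in> A"
  shows "\<exists>v\<in>A. X \<subseteq> {v}"
proof (cases "X = {}")
  case False
  then obtain v where v: "v \<in> X" by blast
  then have "X \<subseteq> {v}" using assms(1,2) card_le_Suc0_iff_eq[of X] by auto
  then show ?thesis using v assms(3) by blast
qed (use assms(4) in blast)

section \<open>Functionals on J and their extension to R\<close>

lemma (in prime_local_ring) pow_mem_J: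
  assumes "x \<in> J"
  shows "[(n::nat)] \<cdot> x \<in> J"
  using assms J.a_closed J.zero_closed by (induction n) auto

text \<open>A linear functional on \<open>J/J^2\<close>, pulled back to \<open>J\<close>, that
  vanishes on the class of \<open>p 1\<close>. The last condition makes its extension to
  \<open>R\<close> by zero on multiples of 1 consistent.\<close>

locale cotangent_functional = prime_local_ring +
  fixes f :: "'a \<Rightarrow> int"
  assumes f_range: "x \<in> J \<Longrightarrow> f x \<in> {0..<int p}"
    and f_add: "\<lbrakk>x \<in> J; y \<in> J\<rbrakk> \<Longrightarrow> f (x \<oplus> y) = (f x + f y) mod int p"
    and f_JJ: "x \<in> J \<cdot> J \<Longrightarrow> f x = 0"
    and f_p: "f ([p] \<cdot> \<one>) = 0"
begin

lemma f_pow: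
  assumes "x \<in> J"
  shows "f ([(n::nat)] \<cdot> x) = int n * f x mod int p"
proof (induction n)
  case 0
  show ?case using f_JJ[OF JJ.zero_closed] by simp
next
  case (Suc n)
  have "f ([Suc n] \<cdot> x) = (int n * f x mod int p + f x) mod int p"
    using f_add[OF pow_mem_J[OF assms] assms, of n] Suc by simp
  also have "\<dots> = int (Suc n) * f x mod int p"
    by (simp add: mod_add_left_eq mod_add_right_eq algebra_simps)
  finally show ?case .
qed

definition ext :: "'a \<Rightarrow> int" where
  "ext r = f (r \<ominus> [nat (g r)] \<cdot> \<one>)"

lemma g_of_nat_add:
  assumes "j \<in> J"
  shows "g ([k] \<cdot> \<one> \<oplus> j) = int k mod int p"
  using assms J.a_Hcarr g_eq_0_iff[of j] by (simp add: g_add g_of_nat)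

text \<open>The definition of \<open>ext\<close> uses the reduced multiple of 1. Any other choice of
  \<open>k\<close> changes the part in \<open>J\<close> by a multiple of \<open>p 1\<close>, on
  which \<open>f\<close> vanishes.\<close>

lemma ext_eq:
  assumes j: "j \<in> J"
  shows "ext ([(k::nat)] \<cdot> \<one> \<oplus> j) = f j"
proof -
  have jR: "j \<in> carrier R" using j by (rule J.a_Hcarr)
  let ?m = "k mod p" and ?q = "[(k div p)] \<cdot> ([p] \<cdot> \<one>)"
  have "[k] \<cdot> \<one> = [(p * (k div p) + k mod p)] \<cdot> \<one>" by simp
  also have "\<dots> = [(p * (k div p))] \<cdot> \<one> \<oplus> [?m] \<cdot> \<one>"
    by (rule add.nat_pow_mult[symmetric]) simp
  also have "[(p * (k div p))] \<cdot> \<one> = ?q" by (rule add.nat_pow_pow[symmetric]) simp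
  finally have "[k] \<cdot> \<one> \<oplus> j \<ominus> [?m] \<cdot> \<one> = ?q \<oplus> j"
    using jR by (simp add: minus_eq a_ac r_neg1 r_neg2 r_neg)
  moreover have "nat (g ([k] \<cdot> \<one> \<oplus> j)) = ?m"
    using j by (simp add: g_of_nat_add flip: of_nat_mod)
  ultimately have "ext ([k] \<cdot> \<one> \<oplus> j) = f (?q \<oplus> j)" by (simp add: ext_def)
  also have "\<dots> = (f ?q + f j) mod int p" using pow_mem_J[OF p_mem] j by (rule f_add)
  also have "\<dots> = f j" using f_pow[OF p_mem] f_p f_range[OF j] by simp
  finally show ?thesis .
qed

lemma ext_range:
  assumes "r \<in> carrier R"
  shows "ext r \<in> {0..<int p}"
proof -
  obtain k :: nat and j where j: "j \<in> J" "r = [k] \<cdot> \<one> \<oplus> j" by (rule decompose[OF assms])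
  show ?thesis unfolding j(2) ext_eq[OF j(1)] by (rule f_range[OF j(1)])
qed

lemma ext_one: "ext \<one> = 0"
  using ext_eq[OF J.zero_closed, of 1] f_JJ[OF JJ.zero_closed] by simp

lemma ext_add:
  assumes "x \<in> carrier R" "y \<in> carrier R"
  shows "ext (x \<oplus> y) = (ext x + ext y) mod int p"
proof -
  obtain a :: nat and i where i: "i \<in> J" "x = [a] \<cdot> \<one> \<oplus> i" by (rule decompose[OF assms(1)])
  obtain b :: nat and j where j: "j \<in> J" "y = [b] \<cdot> \<one> \<oplus> j" by (rule decompose[OF assms(2)])
  have "x \<oplus> y = [(a + b)] \<cdot> \<one> \<oplus> (i \<oplus> j)"
    using i j J.a_Hcarr by (simp add: add.nat_pow_mult[symmetric] a_ac)
  then have "ext (x \<oplus> y) = f (i \<oplus> j)" using ext_eq J.a_closed i(1) j(1) by simp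
  then show ?thesis using f_add i j ext_eq by simp
qed

text \<open>\<open>ext\<close> is a derivation along \<open>g\<close>: in
  \<open>(a + i)(b + j)\<close> the part in \<open>J\<close> is \<open>a j + b i + i j\<close>, and
  \<open>f\<close> kills \<open>i j\<close>, which lies in \<open>J^2\<close>.\<close>

lemma ext_mult:
  assumes "x \<in> carrier R" "y \<in> carrier R"
  shows "ext (x \<otimes> y) = (g x * ext y + ext x * g y) mod int p"
proof -
  obtain a :: nat and i where i: "i \<in> J" "x = [a] \<cdot> \<one> \<oplus> i" by (rule decompose[OF assms(1)])
  obtain b :: nat and j where j: "j \<in> J" "y = [b] \<cdot> \<one> \<oplus> j" by (rule decompose[OF assms(2)])
  have R: "i \<in> carrier R" "j \<in> carrier R" using i j J.a_Hcarr by auto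
  have "i \<otimes> j \<in> J \<cdot> J" using i(1) j(1) by (rule ideal_prod.prod)
  then have ij: "f (i \<otimes> j) = 0" "i \<otimes> j \<in> J" using f_JJ i(1) R(2) J.I_r_closed by auto
  have mems: "[a] \<cdot> j \<in> J" "[b] \<cdot> i \<in> J" using i(1) j(1) pow_mem_J by auto
  have ab: "[a] \<cdot> \<one> \<otimes> [b] \<cdot> \<one> = [(a * b)] \<cdot> \<one>" "[a] \<cdot> \<one> \<otimes> j = [a] \<cdot> j" "i \<otimes> [b] \<cdot> \<one> = [b] \<cdot> i"
    using R by (simp_all add: add_pow_ldistr add_pow_rdistr add.nat_pow_pow mult.commute)
  have "x \<otimes> y = [a] \<cdot> \<one> \<otimes> [b] \<cdot> \<one> \<oplus> [a] \<cdot> \<one> \<otimes> j \<oplus> (i \<otimes> [b] \<cdot> \<one> \<oplus> i \<otimes> j)"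
    unfolding i(2) j(2) using R by (simp add: l_distr r_distr a_ac)
  also have "\<dots> = [(a * b)] \<cdot> \<one> \<oplus> ([a] \<cdot> j \<oplus> ([b] \<cdot> i \<oplus> i \<otimes> j))"
    unfolding ab using R by (simp add: a_assoc)
  finally have "ext (x \<otimes> y) = f ([a] \<cdot> j \<oplus> ([b] \<cdot> i \<oplus> i \<otimes> j))"
    using ext_eq mems ij J.a_closed by simp
  also have "\<dots> = (int a * f j mod int p + (int b * f i mod int p + 0) mod int p) mod int p"
    using f_add[OF mems(1) J.a_closed[OF mems(2) ij(2)]] f_add[OF mems(2) ij(2)]
      f_pow[OF i(1)] f_pow[OF j(1)] ij(1) by simp
  also have "\<dots> = (int a * f j + int b * f i) mod int p" by (simp add: mod_add_eq)
  also have "\<dots> = ((int a mod int p) * f j + f i * (int b mod int p)) mod int p"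
    by (simp add: lincomb_mod_eq mod_mult_left_eq mod_mult_right_eq mult.commute
        mod_add_cong[OF mod_mult_left_eq mod_mult_right_eq])
  finally show ?thesis
    using g_of_nat_add[OF i(1)] g_of_nat_add[OF j(1)] ext_eq[OF i(1)] ext_eq[OF j(1)] i(2) j(2) by simp
qed

end

text \<open>The residue and the two extended functionals are the three coordinates of the map; the
  product rule for \<open>ext\<close> is the multiplication of \<open>dual_plane\<close>. A preimage
  of \<open>(a, b, c)\<close> is \<open>a 1 + b x + c y\<close>.\<close>

lemma (in prime_local_ring) dual_plane_surj:
  assumes "cotangent_functional R p J g f1" and "cotangent_functional R p J g f2"
    and x: "x \<in> J" "f1 x = 1" "f2 x = 0"
    and y: "y \<in> J" "f1 y = 0" "f2 y = 1"
  shows "\<exists>h. ring_hom_ring R (dual_plane p) h \<and> h ` carrier R = carrier (dual_plane p)"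
proof -
  interpret f1: cotangent_functional R p J g f1 by fact
  interpret f2: cotangent_functional R p J g f2 by fact
  interpret D: cring "dual_plane p" by (rule dual_plane_cring[OF p_gt_1])
  define h where "h r = (g r, f1.ext r, f2.ext r)" for r
  have hom: "ring_hom_ring R (dual_plane p) h"
  proof (rule ring_hom_ringI)
    fix r assume r: "r \<in> carrier R"
    show "h r \<in> carrier (dual_plane p)"
      using g_range[OF r r] f1.ext_range[OF r] f2.ext_range[OF r]
      by (simp add: h_def dual_plane_simps)
  next
    fix r s assume rs: "r \<in> carrier R" "s \<in> carrier R"
    show "h (r \<otimes> s) = h r \<otimes>\<^bsub>dual_plane p\<^esub> h s"
      by (simp add: h_def dual_plane_simps g_mult[OF rs] f1.ext_mult[OF rs] f2.ext_mult[OF rs])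
    show "h (r \<oplus> s) = h r \<oplus>\<^bsub>dual_plane p\<^esub> h s"
      by (simp add: h_def dual_plane_simps g_add[OF rs] f1.ext_add[OF rs] f2.ext_add[OF rs])
  next
    show "h \<one> = \<one>\<^bsub>dual_plane p\<^esub>"
      by (simp add: h_def dual_plane_simps g_one f1.ext_one f2.ext_one)
  qed (rule ring_axioms D.ring_axioms)+
  interpret h: ring_hom_ring R "dual_plane p" h by (rule hom)
  have "carrier (dual_plane p) \<subseteq> h ` carrier R"
  proof
    fix z assume "z \<in> carrier (dual_plane p)"
    then obtain a b c where z: "z = (a, b, c)" "0 \<le> a" "a < p" "0 \<le> b" "b < p" "0 \<le> c" "c < p"
      by (auto simp: dual_plane_simps)
    let ?j = "[nat b] \<cdot> x \<oplus> [nat c] \<cdot> y"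
    have mems: "[nat b] \<cdot> x \<in> J" "[nat c] \<cdot> y \<in> J" using x(1) y(1) pow_mem_J by auto
    have j: "?j \<in> J" using mems by (rule J.a_closed)
    have "h ([nat a] \<cdot> \<one> \<oplus> ?j) = z"
      using z x(2,3) y(2,3)
      by (simp add: h_def f1.ext_eq[OF j] f2.ext_eq[OF j] f1.g_of_nat_add[OF j]
          f1.f_add[OF mems] f2.f_add[OF mems] f1.f_pow[OF x(1)] f1.f_pow[OF y(1)]
          f2.f_pow[OF x(1)] f2.f_pow[OF y(1)])
    moreover have "[nat a] \<cdot> \<one> \<oplus> ?j \<in> carrier R" using J.a_Hcarr[OF j] by blast
    ultimately show "z \<in> h ` carrier R" by blast
  qed
  then show ?thesis using hom h.hom_closed by blast
qed

section \<open>The two cases according to the dimension of the cotangent space\<close>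

context prime_local_ring
begin

abbreviation "J2 \<equiv> ideal_prod R J J"
abbreviation "cls \<equiv> a_r_coset R J2"
abbreviation "V \<equiv> cotangent_space p R J"

lemma cotangent_simps:
  "carrier V = cls ` J"
  "\<zero>\<^bsub>V\<^esub> = J2"
  "\<lbrakk>x \<in> J; y \<in> J\<rbrakk> \<Longrightarrow> cls x \<oplus>\<^bsub>V\<^esub> cls y = cls (x \<oplus> y)"
  "\<lbrakk>x \<in> J; 0 \<le> k\<rbrakk> \<Longrightarrow> k \<odot>\<^bsub>V\<^esub> cls x = cls ([nat k] \<cdot> x)"
proof -
  let ?Q = "R Quot J2"
  interpret h: ring_hom_ring R ?Q cls by (rule JJ.rcos_ring_hom_ring)
  show "carrier V = cls ` J" "\<zero>\<^bsub>V\<^esub> = J2"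
    unfolding cotangent_space_def Let_def FactRing_def
    by (simp_all only: partial_object.select_convs ring.select_convs)
  have sel: "add V = add ?Q" "smult V = (\<lambda>k X. add_pow ?Q k X)"
    unfolding cotangent_space_def Let_def by (simp_all only: ring.select_convs module.select_convs)
  show "cls x \<oplus>\<^bsub>V\<^esub> cls y = cls (x \<oplus> y)" if "x \<in> J" "y \<in> J"
    unfolding sel by (rule h.hom_add[symmetric]) (use that J.a_Hcarr in auto)
  have pow: "add_pow ?Q n (cls x) = cls ([n] \<cdot> x)" if "x \<in> carrier R" for n :: nat and x
  proof (induction n)
    case (Suc n)
    have "add_pow ?Q (Suc n) (cls x) = cls ([n] \<cdot> x) \<oplus>\<^bsub>?Q\<^esub> cls x" using Suc by simp
    also have "\<dots> = cls ([n] \<cdot> x \<oplus> x)" by (rule h.hom_add[symmetric]) (use that in auto)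
    finally show ?case by simp
  qed (simp add: h.hom_zero)
  show "k \<odot>\<^bsub>V\<^esub> cls x = cls ([nat k] \<cdot> x)" if "x \<in> J" "0 \<le> k"
  proof -
    have "add_pow ?Q k (cls x) = add_pow ?Q (int (nat k)) (cls x)" using that(2) by simp
    also have "\<dots> = add_pow ?Q (nat k) (cls x)" unfolding add_pow_def by (rule int_pow_int)
    finally show ?thesis unfolding sel using pow[OF J.a_Hcarr[OF that(1)]] by metis
  qed
qed

lemma cls_eq_zero_iff:
  assumes "x \<in> J"
  shows "cls x = J2 \<longleftrightarrow> x \<in> J2"
  using a_rcos_zero[OF JJ.is_ideal, of x] JJ.a_rcos_self[of x] J.a_Hcarr[OF assms] by auto

lemma cls_eq_imp:
  assumes "x \<in> J" "y \<in> J" "cls x = cls y"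
  shows "\<exists>t\<in>J2. x = y \<oplus> t"
proof -
  have R: "x \<in> carrier R" "y \<in> carrier R" using assms J.a_Hcarr by auto
  have "x \<in> cls y" using JJ.a_rcos_self[OF R(1)] assms(3) by simp
  then obtain t where "t \<in> J2" "x = t \<oplus> y" by (auto simp: a_r_coset_def')
  then show ?thesis using R(2) JJ.a_Hcarr a_comm by auto
qed

sublocale V: vectorspace "prime_field p" V
  by (rule cotangent_space_vectorspace[OF prime is_cring J_ideal p_mem])

lemma prime_field_simps:
  "carrier (prime_field p) = {0..<int p}"
  "\<zero>\<^bsub>prime_field p\<^esub> = 0" "\<one>\<^bsub>prime_field p\<^esub> = 1"
  "a \<oplus>\<^bsub>prime_field p\<^esub> b = (a + b) mod int p"
  by (auto simp: residue_ring_def)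

lemma finite_V: "finite (carrier V)"
proof -
  have "J \<subseteq> carrier R" using J.a_Hcarr by auto
  then have "finite J" using fin by (rule finite_subset)
  then show ?thesis by (simp add: cotangent_simps(1))
qed

text \<open>The class of \<open>p 1\<close> belongs to the basis exactly when it is nonzero, since a
  basis does not contain zero. Removing it from the basis therefore leaves \<open>n\<close> or
  \<open>n - 1\<close> elements, which is how the two cases of the theorem are told apart.\<close>

lemma cotangent_basis:
  obtains B where "V.basis B" "finite B" "card B = cotangent_dim p R J" "B \<subseteq> cls ` J"
    and "[p] \<cdot> \<one> \<in> J2 \<and> cls ([p] \<cdot> \<one>) \<notin> B \<or> [p] \<cdot> \<one> \<notin> J2 \<and> cls ([p] \<cdot> \<one>) \<in> B"
proof -
  have u: "cls ([p] \<cdot> \<one>) \<in> carrier V" using p_mem by (simp add: cotangent_simps(1))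
  obtain B where B: "V.basis B" "finite B" "cls ([p] \<cdot> \<one>) = \<zero>\<^bsub>V\<^esub> \<or> cls ([p] \<cdot> \<one>) \<in> B"
    using V.basis_containing[OF finite_V u] by blast
  have BV: "B \<subseteq> carrier V" using B(1) by (simp add: V.basis_def)
  have "\<zero>\<^bsub>V\<^esub> \<notin> B" using B(1) by (intro V.vs_zero_lin_dep) (auto simp: V.basis_def)
  then have "[p] \<cdot> \<one> \<in> J2 \<and> cls ([p] \<cdot> \<one>) \<notin> B \<or> [p] \<cdot> \<one> \<notin> J2 \<and> cls ([p] \<cdot> \<one>) \<in> B"
    using B(3) cls_eq_zero_iff[OF p_mem] by (auto simp: cotangent_simps(2))
  moreover have "card B = cotangent_dim p R J"
    unfolding cotangent_dim_def using V.dim_basis[OF B(2,1)] by simp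
  ultimately show ?thesis using that B BV by (simp add: cotangent_simps(1))
qed

text \<open>Apart from the class of \<open>p 1\<close> the basis has at most one element, the class
  of some \<open>x\<close>. It remains to verify the generation premise of
  \<open>not_coverable\<close> for this \<open>x\<close>.\<close>

lemma not_coverable_of_dim:
  assumes n: "n = cotangent_dim p R J" "n \<le> 1 \<or> n = 2 \<and> [p] \<cdot> \<one> \<notin> J2"
  shows "\<not> coverable R"
proof -
  obtain B where B: "V.basis B" "finite B" "card B = n" "B \<subseteq> cls ` J"
    and pB: "[p] \<cdot> \<one> \<in> J2 \<and> cls ([p] \<cdot> \<one>) \<notin> B \<or> [p] \<cdot> \<one> \<notin> J2 \<and> cls ([p] \<cdot> \<one>) \<in> B"
    using cotangent_basis n(1) by metis
  have "card (B - {cls ([p] \<cdot> \<one>)}) \<le> 1"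
    using B(2,3) pB n(2) by (auto simp: card_Diff_singleton_if)
  moreover have "B - {cls ([p] \<cdot> \<one>)} \<subseteq> cls ` J" using B(4) by blast
  ultimately have "\<exists>v\<in>cls ` J. B - {cls ([p] \<cdot> \<one>)} \<subseteq> {v}"
    using B(2) p_mem by (intro subset_singleton_of_card_le_1 imageI) auto
  then obtain x where x: "x \<in> J" "B \<subseteq> {cls ([p] \<cdot> \<one>), cls x}" by auto
  show ?thesis
  proof (rule not_coverable[OF x(1)])
    fix j S assume j: "j \<in> J" and S: "subrng S R" "x \<in> S" "[p] \<cdot> \<one> \<in> S"
    interpret S: additive_subgroup S R using S(1) by (simp add: subrng_def)
    \<comment> \<open>The image of \<open>S \<inter> J\<close> is a subspace, scalars acting as
      repeated sums. It contains the basis, so it is the whole cotangent space.\<close>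
    let ?W = "cls ` (S \<inter> J)"
    have "LinearCombinations.submodule (prime_field p) ?W V"
    proof (rule LinearCombinations.submodule.intro)
      show "?W \<subseteq> carrier V" by (auto simp: cotangent_simps(1))
      show "v \<oplus>\<^bsub>V\<^esub> w \<in> ?W" if "v \<in> ?W" "w \<in> ?W" for v w
        using that S.a_closed J.a_closed by (auto simp: cotangent_simps(3))
      have "\<zero>\<^bsub>V\<^esub> = cls \<zero>"
        using cls_eq_zero_iff[OF J.zero_closed] JJ.zero_closed by (simp add: cotangent_simps(2))
      then show "\<zero>\<^bsub>V\<^esub> \<in> ?W" using S.zero_closed J.zero_closed by blast
      show "c \<odot>\<^bsub>V\<^esub> v \<in> ?W" if c: "c \<in> carrier (prime_field p)" and "v \<in> ?W" for c v
      proof -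
        obtain s where s: "s \<in> S" "s \<in> J" "v = cls s" using \<open>v \<in> ?W\<close> by blast
        have "c \<odot>\<^bsub>V\<^esub> v = cls ([nat c] \<cdot> s)"
          using c s cotangent_simps(4)[of s c] by (simp add: prime_field_simps(1))
        moreover have "[nat c] \<cdot> s \<in> S \<inter> J"
          using s subrng_add_pow_closed[OF S(1) ring_axioms] pow_mem_J by blast
        ultimately show ?thesis by blast
      qed
    qed (rule V.module_axioms)
    then have "V.span B \<subseteq> ?W"
      using x S p_mem by (intro V.span_is_subset) auto
    then have "cls j \<in> ?W"
      using B(1) j by (auto simp: V.basis_def cotangent_simps(1))
    then obtain s where s: "s \<in> S \<inter> J" "cls j = cls s" by auto
    then show "\<exists>s\<in>S \<inter> J. \<exists>t\<in>J2. j = s \<oplus> t" using cls_eq_imp[OF j] by blast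
  qed
qed

text \<open>Two basis elements remain besides the class of \<open>p 1\<close>, and their coordinate
  functionals supply the two functionals for \<open>dual_plane_surj\<close>.\<close>

lemma dual_plane_surj_of_dim:
  assumes n: "n = cotangent_dim p R J" "\<not> (n \<le> 1 \<or> n = 2 \<and> [p] \<cdot> \<one> \<notin> J2)"
  shows "\<exists>h. ring_hom_ring R (dual_plane p) h \<and> h ` carrier R = carrier (dual_plane p)"
proof -
  obtain B where B: "V.basis B" "finite B" "card B = n" "B \<subseteq> cls ` J"
    and pB: "[p] \<cdot> \<one> \<in> J2 \<and> cls ([p] \<cdot> \<one>) \<notin> B \<or> [p] \<cdot> \<one> \<notin> J2 \<and> cls ([p] \<cdot> \<one>) \<in> B"
    using cotangent_basis n(1) by metis
  have "\<not> card (B - {cls ([p] \<cdot> \<one>)}) \<le> 1"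
    using B(2,3) pB n(2) by (auto simp: card_Diff_singleton_if)
  then obtain e1 e2 where e: "e1 \<in> B" "e2 \<in> B" "e1 \<noteq> e2" "e1 \<noteq> cls ([p] \<cdot> \<one>)" "e2 \<noteq> cls ([p] \<cdot> \<one>)"
    using B(2) by (auto simp: card_le_Suc0_iff_eq)
  have functional: "\<exists>f. cotangent_functional R p J g f \<and> (\<forall>x\<in>J. cls x \<in> B \<longrightarrow> f x = (if cls x = e then 1 else 0))"
    if eB: "e \<in> B" "e \<noteq> cls ([p] \<cdot> \<one>)" for e
  proof -
    obtain c where c: "c \<in> carrier V \<rightarrow> carrier (prime_field p)"
      "\<forall>v\<in>carrier V. \<forall>w\<in>carrier V. c (v \<oplus>\<^bsub>V\<^esub> w) = c v \<oplus>\<^bsub>prime_field p\<^esub> c w"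
      "\<forall>b\<in>B. c b = (if b = e then \<one>\<^bsub>prime_field p\<^esub> else \<zero>\<^bsub>prime_field p\<^esub>)"
      using V.coordinate_functional[OF B(1,2) eB(1)] by blast
    have range: "c (cls x) \<in> {0..<int p}" if "x \<in> J" for x
      using c(1) that by (auto simp: cotangent_simps(1) prime_field_simps)
    have add: "c (cls (x \<oplus> y)) = (c (cls x) + c (cls y)) mod int p" if "x \<in> J" "y \<in> J" for x y
      using c(2)[rule_format, of "cls x" "cls y"] that by (simp add: cotangent_simps prime_field_simps)
    have zero: "c (cls \<zero>) = 0"
    proof -
      let ?z = "c (cls \<zero>)"
      have z: "0 \<le> ?z" "?z < int p" using range[OF J.zero_closed] by simp_all
      have "?z = (?z + ?z) mod int p" using add[OF J.zero_closed J.zero_closed] by simp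
      then have "(?z + ?z) mod int p = ?z mod int p" using z by simp
      then have "int p dvd ?z" by (simp add: mod_eq_dvd_iff)
      then show ?thesis using z zdvd_not_zless[of ?z "int p"] by linarith
    qed
    have JJ0: "c (cls x) = 0" if "x \<in> J2" for x
    proof -
      have "cls x = cls \<zero>"
        using a_rcos_zero[OF JJ.is_ideal that] a_rcos_zero[OF JJ.is_ideal JJ.zero_closed] by simp
      then show ?thesis using zero by simp
    qed
    \<comment> \<open>The class of \<open>p 1\<close> is either zero or a basis element other than
      \<open>e\<close>; both have coordinate 0 at \<open>e\<close>.\<close>
    have "c (cls ([p] \<cdot> \<one>)) = 0"
      using pB JJ0[of "[p] \<cdot> \<one>"] c(3)[rule_format, of "cls ([p] \<cdot> \<one>)"] eB(2) by (auto simp: prime_field_simps)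
    then have "cotangent_functional R p J g (\<lambda>x. c (cls x))"
      using range add JJ0 by unfold_locales
    moreover have "\<forall>x\<in>J. cls x \<in> B \<longrightarrow> c (cls x) = (if cls x = e then 1 else 0)"
      using c(3) by (simp add: prime_field_simps)
    ultimately show ?thesis by blast
  qed
  obtain x y where xy: "x \<in> J" "y \<in> J" "e1 = cls x" "e2 = cls y" using e(1,2) B(4) by blast
  obtain f1 where f1: "cotangent_functional R p J g f1"
    "\<forall>x\<in>J. cls x \<in> B \<longrightarrow> f1 x = (if cls x = e1 then 1 else 0)"
    using functional[OF e(1,4)] by blast
  obtain f2 where f2: "cotangent_functional R p J g f2"
    "\<forall>x\<in>J. cls x \<in> B \<longrightarrow> f2 x = (if cls x = e2 then 1 else 0)"
    using functional[OF e(2,5)] by blast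
  note B_xy = e(1)[unfolded xy(3)] e(2)[unfolded xy(4)] and ne = e(3)[unfolded xy(3,4)]
  have f1_xy: "f1 x = 1" "f1 y = 0"
    using f1(2)[rule_format, OF xy(1) B_xy(1)] f1(2)[rule_format, OF xy(2) B_xy(2)] ne[symmetric]
    unfolding xy(3) by simp_all
  have f2_xy: "f2 x = 0" "f2 y = 1"
    using f2(2)[rule_format, OF xy(1) B_xy(1)] f2(2)[rule_format, OF xy(2) B_xy(2)] ne
    unfolding xy(4) by simp_all
  show ?thesis
    by (rule dual_plane_surj[OF f1(1) f2(1) xy(1) f1_xy(1) f2_xy(1) xy(2) f1_xy(2) f2_xy(2)])
qed

end

subsection \<open>The theorem\<close>

lemma (in ring) maximalideal_exists:
  assumes fin: "finite (carrier R)" and I: "ideal I R" "I \<noteq> carrier R"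
  shows "\<exists>M. maximalideal M R \<and> I \<subseteq> M"
proof -
  define \<S> where "\<S> = {K. ideal K R \<and> I \<subseteq> K \<and> K \<noteq> carrier R}"
  have "K \<subseteq> carrier R" if "K \<in> \<S>" for K
    using that additive_subgroup.a_subset[of K R] ideal.axioms(1)[of K R] by (simp add: \<S>_def)
  then have "\<S> \<subseteq> Pow (carrier R)" by blast
  then have "finite \<S>" by (rule finite_subset) (simp add: fin)
  moreover have "I \<in> \<S>" using I by (simp add: \<S>_def)
  ultimately have "\<exists>M\<in>\<S>. I \<subseteq> M \<and> (\<forall>K\<in>\<S>. M \<subseteq> K \<longrightarrow> M = K)" by (rule finite_has_maximal2)
  then obtain M where M: "M \<in> \<S>" "\<forall>K\<in>\<S>. M \<subseteq> K \<longrightarrow> M = K" by blast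
  then have M': "ideal M R" "I \<subseteq> M" "M \<noteq> carrier R" by (simp_all add: \<S>_def)
  have "maximalideal M R"
  proof (rule maximalidealI)
    show "K = M \<or> K = carrier R" if "ideal K R" "M \<subseteq> K" for K
    proof (cases "K = carrier R")
      case False
      then have "K \<in> \<S>" using that M'(2) by (simp add: \<S>_def)
      then show ?thesis using M(2) that(2) by blast
    qed blast
  qed (use M' in simp_all)
  then show ?thesis using M'(2) by blast
qed

text \<open>The radical is the unique maximal ideal \<open>M\<close>, and \<open>g\<close> is the
  quotient map followed by the given isomorphism. A non-unit generates a proper ideal, which lies in
  a maximal ideal and hence in \<open>M\<close>.\<close>

lemma local_cring_prime_local_ring:
  fixes R (structure)
  assumes p: "Factorial_Ring.prime p" and loc: "local_cring R" and fin: "finite (carrier R)"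
    and J: "J = jacobson_radical R" and iso: "R Quot J \<simeq> prime_field p"
  shows "\<exists>g. prime_local_ring R p J g"
proof -
  interpret cring R using loc by (simp add: local_cring_def)
  obtain M where M: "maximalideal M R" "\<And>N. maximalideal N R \<Longrightarrow> N = M"
    using loc by (auto simp: local_cring_def)
  interpret M: maximalideal M R by (rule M(1))
  have "{N. maximalideal N R} = {M}" using M by blast
  moreover have "M \<subseteq> carrier R" by (rule M.a_subset)
  ultimately have JM: "J = M" unfolding J jacobson_radical_def by auto
  interpret Q: ring "R Quot M" by (rule M.quotient_is_ring)
  interpret F: cring "prime_field p"
    using prime_gt_1_nat[OF p] by (intro residues.cring) (simp add: residues_def)
  obtain f where f: "f \<in> ring_iso (R Quot M) (prime_field p)"
    using iso JM by (auto simp: is_ring_iso_def)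
  then have f_hom: "f \<in> ring_hom (R Quot M) (prime_field p)"
    and f_inj: "inj_on f (carrier (R Quot M))"
    by (auto simp: ring_iso_def bij_betw_def)
  have f0: "f M = 0"
    using ring_hom_zero[OF f_hom Q.ring_axioms F.ring_axioms] by (simp add: FactRing_def residue_ring_def)
  have cl: "M +> x \<in> carrier (R Quot M)" if "x \<in> carrier R" for x
    using ring_hom_closed[OF M.rcos_ring_hom that] .
  have M0: "M +> \<zero> = M" by (rule a_rcos_zero[OF M.is_ideal M.zero_closed])
  have "prime_local_ring R p M (\<lambda>x. f (M +> x))"
  proof unfold_locales
    show "Factorial_Ring.prime p" by (rule p)
    show "finite (carrier R)" by (rule fin)
    show "(\<lambda>x. f (M +> x)) \<in> ring_hom R (prime_field p)"
      using ring_hom_trans[OF M.rcos_ring_hom f_hom] unfolding comp_def .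
    show "x \<in> Units R" if x: "x \<in> carrier R" "x \<notin> M" for x
    proof (rule ccontr)
      assume "x \<notin> Units R"
      then have "\<one> \<notin> PIdl x"
        using x(1) m_comm[OF x(1)] unfolding cgenideal_def Units_def by force
      then have "PIdl x \<noteq> carrier R" using one_closed by blast
      then have "\<exists>N. maximalideal N R \<and> PIdl x \<subseteq> N"
        by (rule maximalideal_exists[OF fin cgenideal_ideal[OF x(1)]])
      then obtain N where "maximalideal N R" "PIdl x \<subseteq> N" by blast
      then show False using M(2)[of N] cgenideal_self[OF x(1)] x(2) by blast
    qed
    show "f (M +> x) = 0 \<longleftrightarrow> x \<in> M" if x: "x \<in> carrier R" for x
    proof
      assume "f (M +> x) = 0"
      then have "f (M +> x) = f (M +> \<zero>)" using f0 M0 by simp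
      then have "M +> x = M" using inj_onD[OF f_inj _ cl[OF x] cl[OF zero_closed]] M0 by simp
      then show "x \<in> M" using M.a_rcos_self[OF x] by simp
    next
      assume "x \<in> M"
      then show "f (M +> x) = 0" using f0 a_rcos_zero[OF M.is_ideal] by simp
    qed
  qed
  then show ?thesis using JM by blast
qed

theorem proposition5p1:
  fixes R :: "('a, 'm) ring_scheme" and p n :: nat and J :: "'a set"
  assumes "Factorial_Ring.prime p"
    and "local_cring R"
    and "finite (carrier R)"
    and "J = jacobson_radical R"
    and "R Quot J \<simeq> prime_field p"
    and "n = cotangent_dim p R J"
  shows "(n \<le> 1 \<or> (n = 2 \<and> add_pow R p \<one>\<^bsub>R\<^esub> \<notin> J \<cdot>\<^bsub>R\<^esub> J) \<longrightarrow> \<not> coverable R)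
    \<and> (\<not> (n \<le> 1 \<or> (n = 2 \<and> add_pow R p \<one>\<^bsub>R\<^esub> \<notin> J \<cdot>\<^bsub>R\<^esub> J)) \<longrightarrow>
         coverable R
         \<and> (\<exists>h \<in> ring_hom R (trunc_poly_ring2 p).
               h ` carrier R = carrier (trunc_poly_ring2 p))
         \<and> covering_number R = enat (p + 1))
    \<and> (\<forall>d\<ge>3. in_S d R \<longrightarrow> d = p + 1 \<and> R \<simeq> trunc_poly_ring2 p)"
proof -
  obtain g where "prime_local_ring R p J g"
    using local_cring_prime_local_ring[OF assms(1-5)] by blast
  then interpret prime_local_ring R p J g .
  let ?D = "dual_plane p" and ?T = "trunc_poly_ring2 p"
  let ?P = "n \<le> 1 \<or> (n = 2 \<and> add_pow R p \<one>\<^bsub>R\<^esub> \<notin> J \<cdot>\<^bsub>R\<^esub> J)"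
  have neg: "\<not> coverable R" if ?P using not_coverable_of_dim[OF assms(6) that] .
  have iso: "?D \<simeq> ?T"
    using ring_iso_sym[OF trunc_poly_ring2_iso[OF assms(1)]] .
  obtain \<C> where C: "ring_cover \<C> ?D" "finite \<C>" "card \<C> \<le> p + 1"
    using dual_plane_cover[OF assms(1)] by blast
  have pos: "coverable R \<and> (\<exists>h \<in> ring_hom R ?T. h ` carrier R = carrier ?T)
      \<and> covering_number R = enat (p + 1) \<and> (\<forall>d. in_S d R \<longrightarrow> d = p + 1 \<and> R \<simeq> ?T)" if np: "\<not> ?P"
  proof -
    obtain h where "ring_hom_ring R ?D h" and h_surj: "h ` carrier R = carrier ?D"
      using dual_plane_surj_of_dim[OF assms(6) np] by blast
    then interpret h: ring_hom_ring R ?D h by simp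
    note cov = h.covering_number_le_of_surj[OF h_surj C(1,2)]
    obtain \<phi> where \<phi>: "\<phi> \<in> ring_iso ?D ?T" using iso by (auto simp: is_ring_iso_def)
    then have "\<phi> \<circ> h \<in> ring_hom R ?T"
      by (intro ring_hom_trans[OF h.homh]) (simp add: ring_iso_def)
    moreover have "(\<phi> \<circ> h) ` carrier R = carrier ?T"
      using \<phi> unfolding image_comp[symmetric] h_surj by (simp add: ring_iso_def bij_betw_def)
    ultimately have surj: "\<exists>h \<in> ring_hom R ?T. h ` carrier R = carrier ?T" by blast
    have "covering_number R \<le> enat (p + 1)"
      using cov(2) C(3) by (meson enat_ord_simps(1) order_trans)
    moreover have "enat (p + 1) \<le> covering_number R"
      by (rule covering_number_ge[OF cover_card_ge])
    ultimately have num: "covering_number R = enat (p + 1)" by (rule antisym)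
    have "d = p + 1 \<and> R \<simeq> ?T" if S: "in_S d R" for d
    proof -
      have d: "d = p + 1" using S num by (simp add: in_S_def)
      \<comment> \<open>The quotient by the kernel maps onto \<open>dual_plane\<close> and so is
        covered by at most \<open>d\<close> subrings. The minimality in \<open>in_S\<close> then
        forces the kernel to be zero.\<close>
      let ?K = "a_kernel R ?D h"
      interpret K: ideal ?K R by (rule h.kernel_is_ideal)
      interpret Q: ring "R Quot ?K" by (rule K.quotient_is_ring)
      obtain \<psi> where \<psi>: "\<psi> \<in> ring_iso (R Quot ?K) ?D"
        using h.FactRing_iso[OF h_surj] by (auto simp: is_ring_iso_def)
      then interpret \<psi>: ring_hom_ring "R Quot ?K" ?D \<psi>
        by (intro ring_hom_ringI2 Q.ring_axioms h.S.ring_axioms) (simp add: ring_iso_def)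
      have "\<psi> ` carrier (R Quot ?K) = carrier ?D" using \<psi> by (simp add: ring_iso_def bij_betw_def)
      then have "covering_number (R Quot ?K) \<le> enat (card \<C>)"
        by (rule \<psi>.covering_number_le_of_surj(2)[OF _ C(1,2)])
      also have "\<dots> \<le> enat d" using C(3) d by simp
      finally have "\<not> covering_number (R Quot ?K) > enat d" by simp
      then have "?K = {\<zero>\<^bsub>R\<^esub>}" using S K.ideal_axioms by (auto simp: in_S_def)
      then have "R \<simeq> ?D"
        using ring_iso_trans[OF FactRing_zeroideal(2)] h.FactRing_iso[OF h_surj] by simp
      then show ?thesis using d ring_iso_trans[OF _ iso] by blast
    qed
    then show ?thesis using cov(1) surj num by blast
  qed
  \<comment> \<open>Here the covering number is infinite, so it equals no natural number
    \<open>d\<close>.\<close>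
  have "\<not> in_S d R" if ?P for d
    using covering_number_not_coverable[OF neg[OF that]] by (simp add: in_S_def)
  then show ?thesis using neg pos by (cases ?P) simp_all
qed

end
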